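(* Let $\mu$ be a probability measure on the unit circle $\mathbb{T}$ having infinite support, let $\{\varphi_n(\mu)\}_{n\ge 0}$ be its orthonormal polynomials and $\{\Phi_n(\mu)\}_{n\ge 0}$ its monic orthogonal polynomials, and let $\tau\in\mathbb{T}$. Then the following statements are equivalent. (i) The derived set (set of limit points) of the support of $\mu$ is equal to $\{\tau\}$. (ii) $\lim_{n\to\infty}\int_{\mathbb{T}} f\,|\varphi_n(\mu)|^2\,d\mu=f(\tau)$ for every $\mu$-measurable function $f$ which is bounded on $\mathbb{T}$ and continuous at $\tau$. (iii) For every $\mu$-measurable function $f$ which is bounded on $\mathbb{T}$ and continuous at $\tau$, $\lim_{n\to\infty}\int_{\mathbb{T}} f\,\varphi_n(\mu)\overline{\varphi_{n+k}(\mu)}\,d\mu=f(\tau)\,\delta_{0,k}$ for all $k\in\mathbb{Z}$, and uniformly in $k\in\mathbb{Z}^+$. (iv) $\lim_{n\to\infty}\int_{\mathbb{T}} z\,|\varphi_n(\mu,z)|^2\,d\mu(\theta)=\tau$, where $z=e^{i\theta}$. (v) $\lim_{n\to\infty}\int_{\mathbb{T}} z\,\varphi_n(\mu,z)\overline{\varphi_{n+k}(\mu,z)}\,d\mu(\theta)=\tau\,\delta_{0,k}$ for all $k\in\mathbb{Z}$, and uniformly in $k\in\mathbb{Z}^+$, where $z=e^{i\theta}$. (vi) $\lim_{n\to\infty}\Phi_{n+1}(\mu,0)\,\overline{\Phi_n(\mu,0)}=-\tau$.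
   Context: $\mathbb{T}=\{z\in\mathbb{C}:|z|=1\}$, $\mathbb{Z}^+=\{0,1,2,\dots\}$. A probability measure $\mu$ on $\mathbb{T}$ is identified with a probability measure on $[0,2\pi)$ via $z=e^{i\theta}$, so $\int_{\mathbb{T}}f\,d\mu=\int_0^{2\pi}f(e^{i\theta})\,d\mu(\theta)$. For $\mu$ with infinite support, the orthonormal polynomials $\varphi_n(\mu,z)=\kappa_n(\mu)z^n+\text{lower degree terms}$, $\kappa_n(\mu)>0$, $n\ge0$, are defined by $\int_{\mathbb{T}}\varphi_n(\mu)\overline{\varphi_m(\mu)}\,d\mu=\delta_{m,n}$; the monic orthogonal polynomials are $\Phi_n(\mu)=\kappa_n(\mu)^{-1}\varphi_n(\mu)$. For negative $k$ the integrals in (iii) and (v) are considered for $n\ge -k$. $\delta_{i,j}$ is the Kronecker delta. *)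

theory Defs
  imports "HOL-Probability.Probability" "HOL-Computational_Algebra.Polynomial"
begin

definition circle_prob :: "complex measure \<Rightarrow> bool" where
  "circle_prob \<mu> \<longleftrightarrow>
     prob_space \<mu> \<and> sets \<mu> = sets (restrict_space borel (sphere 0 1))"

definition msupport :: "complex measure \<Rightarrow> complex set" where
  "msupport \<mu> =
     {z \<in> space \<mu>. \<forall>U. open U \<and> z \<in> U \<longrightarrow> emeasure \<mu> (U \<inter> space \<mu>) > 0}"

text \<open>
  If \<open>\<mu>\<close> has infinite support, the following conditions determine \<open>\<phi>\<close> uniquely.
  The leading coefficient \<open>\<kappa>\<close> is a complex number, required to be real and positive.
\<close>

definition orthonormal_polys :: "complex measure \<Rightarrow> (nat \<Rightarrow> complex poly) \<Rightarrow> bool" where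
  "orthonormal_polys \<mu> \<phi> \<longleftrightarrow>
     (\<forall>n. degree (\<phi> n) = n \<and> (\<exists>\<kappa>>0. lead_coeff (\<phi> n) = complex_of_real \<kappa>)) \<and>
     (\<forall>n m. (\<integral>z. poly (\<phi> n) z * cnj (poly (\<phi> m) z) \<partial>\<mu>) = (if m = n then 1 else 0))"

definition monic_poly :: "complex poly \<Rightarrow> complex poly" where
  "monic_poly p = smult (inverse (lead_coeff p)) p"

text \<open>
  Measurability with respect to \<open>\<mu>\<close> refers to the completion of \<open>\<mu>\<close>, so a function
  may differ from a Borel function on a null set. Continuity is relative to the circle.
\<close>

definition test_function :: "complex measure \<Rightarrow> complex \<Rightarrow> (complex \<Rightarrow> complex) \<Rightarrow> bool" where
  "test_function \<mu> \<tau> f \<longleftrightarrow>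
     f \<in> borel_measurable (completion \<mu>) \<and> bounded (f ` sphere 0 1) \<and>
     continuous (at \<tau> within sphere 0 1) f"

definition all_equivalent :: "bool list \<Rightarrow> bool" where
  "all_equivalent Ps \<longleftrightarrow> (\<forall>P\<in>set Ps. \<forall>Q\<in>set Ps. P \<longleftrightarrow> Q)"

end

theory Submission
  imports Defs
begin

text \<open>
Write \<open>\<langle>p, q\<rangle>\<close> for the inner product of \<open>L\<^sup>2(\<mu>)\<close>. All conditions are compared with the statement
that \<open>\<langle>z \<phi>\<^sub>n, \<phi>\<^sub>n\<rangle> \<longlongrightarrow> \<tau>\<close>, which is (iv).

Multiplication by \<open>z\<close> is isometric, so (iv) means that \<open>\<integral>\<bar>z - \<tau>\<bar>\<^sup>2 \<bar>\<phi>\<^sub>n\<bar>\<^sup>2 \<partial>\<mu> \<longlongrightarrow> 0\<close>: the probability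
measures \<open>\<bar>\<phi>\<^sub>n\<bar>\<^sup>2 \<mu>\<close> concentrate at \<open>\<tau>\<close>. A Chebyshev bound gives (ii) (\<open>weak_limit\<close>); applying (ii) to
\<open>\<bar>f - f \<tau>\<bar>\<^sup>2\<close> and using Cauchy-Schwarz gives (iii) with uniformity in the second index
(\<open>matrix_entries_uniform\<close>); (v) is the case \<open>f z = z\<close> of (iii), and (iv) the case \<open>k = 0\<close> of (v).
The equivalence with (vi) is the identity \<open>\<langle>z \<phi>\<^sub>n, \<phi>\<^sub>n\<rangle> = - \<Phi>\<^sub>n\<^sub>+\<^sub>1(0) cnj (\<Phi>\<^sub>n(0))\<close>
(\<open>ip_shift_onp_self\<close>), a consequence of the Szego recurrence.

If (i) holds, then away from \<open>\<tau>\<close> the measure consists of finitely many atoms, and at an atom \<open>x\<close>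
the values \<open>\<phi>\<^sub>n(x)\<close> are square summable by Bessel's inequality. So \<open>\<bar>\<phi>\<^sub>n\<bar>\<^sup>2 \<mu>\<close> concentrates at \<open>\<tau>\<close>
(\<open>residual_tendsto_0_of_limit_points\<close>).

The substantial direction is from (iv) to (i). Since \<open>\<bar>\<Phi>\<^sub>n(0)\<bar> \<le> 1\<close>, the identity above forces
\<open>\<bar>\<Phi>\<^sub>n(0)\<bar> \<longlongrightarrow> 1\<close>, so that \<open>\<kappa>\<^sub>n / \<kappa>\<^sub>n\<^sub>+\<^sub>1 \<longlongrightarrow> 0\<close>. The entries of the matrix of multiplication by \<open>z\<close> off its
diagonal contain products of such ratios, hence decay geometrically, and multiplication by \<open>z - \<tau>\<close> is
compact: it is small on all polynomials orthogonal to \<open>\<phi>\<^sub>0, \<dots>, \<phi>\<^sub>N\<^sub>-\<^sub>1\<close> for large \<open>N\<close>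
(\<open>tail_residual_small\<close>). On the other hand, near a limit point \<open>w \<noteq> \<tau>\<close> of the support there are points
\<open>x\<close> of the support with light neighbourhoods, and for large \<open>K\<close> the polynomials \<open>(z + x)\<^sup>K\<close> are
concentrated there, almost orthogonal to \<open>\<phi>\<^sub>0, \<dots>, \<phi>\<^sub>N\<^sub>-\<^sub>1\<close>, and satisfy \<open>\<parallel>(z - \<tau>) p\<parallel> \<ge> c \<parallel>p\<parallel>\<close> with \<open>c\<close>
depending only on \<open>\<bar>w - \<tau>\<bar>\<close> (\<open>almost_orthogonal_peak\<close>). This contradicts smallness, so \<open>\<tau>\<close> is the only
possible limit point (\<open>limit_point_unique\<close>); the support is infinite in a compact set, so there is one.
\<close>

lemma integral_Cauchy_Schwarz:
  fixes f g :: "'a \<Rightarrow> complex"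
  assumes "f \<in> borel_measurable M" "g \<in> borel_measurable M"
    and f: "integrable M (\<lambda>x. (cmod (f x))\<^sup>2)" and g: "integrable M (\<lambda>x. (cmod (g x))\<^sup>2)"
  shows "(cmod (\<integral>x. f x * g x \<partial>M))\<^sup>2 \<le> (\<integral>x. (cmod (f x))\<^sup>2 \<partial>M) * (\<integral>x. (cmod (g x))\<^sup>2 \<partial>M)"
proof (cases "integrable M (\<lambda>x. f x * g x)")
  case True
  have "ennreal ((cmod (\<integral>x. f x * g x \<partial>M))\<^sup>2) \<le> (\<integral>\<^sup>+x. ennreal (cmod (f x * g x)) \<partial>M)\<^sup>2"
    using integral_norm_bound_ennreal[OF True] by (simp add: power_mono flip: ennreal_power)
  also have "\<dots> \<le> (\<integral>\<^sup>+x. (ennreal (cmod (f x)))\<^sup>2 \<partial>M) * (\<integral>\<^sup>+x. (ennreal (cmod (g x)))\<^sup>2 \<partial>M)"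
    unfolding norm_mult ennreal_mult[OF norm_ge_zero norm_ge_zero]
    by (rule Cauchy_Schwarz_nn_integral) (use assms in measurable)
  also have "\<dots> = ennreal ((\<integral>x. (cmod (f x))\<^sup>2 \<partial>M) * (\<integral>x. (cmod (g x))\<^sup>2 \<partial>M))"
    using nn_integral_eq_integral[OF f] nn_integral_eq_integral[OF g]
    by (simp add: ennreal_mult ennreal_power)
  finally show ?thesis
    by (simp add: ennreal_le_iff)
qed (simp add: not_integrable_integral_eq)

lemma smult_sum_right: "smult a (\<Sum>i\<in>A. f i) = (\<Sum>i\<in>A. smult a (f i))"
  by (induction A rule: infinite_finite_induct) (simp_all add: smult_add_right)

section \<open>Polynomials in \<open>L\<^sup>2\<close> of a measure on the circle\<close>

locale circle_measure =
  fixes \<mu> :: "complex measure"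
  assumes circle: "circle_prob \<mu>"

begin

sublocale prob_space \<mu>
  using circle by (simp add: circle_prob_def)

lemma sets_circle: "sets \<mu> = sets (restrict_space borel (sphere 0 1))"
  using circle by (simp add: circle_prob_def)

lemma space_circle: "space \<mu> = sphere 0 1"
  using sets_eq_imp_space_eq[OF sets_circle] by (simp add: space_restrict_space)

lemma borel_Int_circle: "A \<in> sets borel \<Longrightarrow> A \<inter> sphere 0 1 \<in> sets \<mu>"
  by (auto simp: sets_circle sets_restrict_space)

lemma measurable_continuous:
  fixes f :: "complex \<Rightarrow> 'b::topological_space"
  assumes "continuous_on (sphere 0 1) f"
  shows "f \<in> borel_measurable \<mu>"
  using borel_measurable_continuous_on_restrict[OF assms] measurable_cong_sets[OF sets_circle refl]
  by blast

lemma integrable_continuous: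
  fixes f :: "complex \<Rightarrow> 'b::{banach, second_countable_topology}"
  assumes "continuous_on (sphere 0 1) f"
  shows "integrable \<mu> f"
proof -
  have "bounded (f ` sphere 0 1)"
    by (intro compact_imp_bounded compact_continuous_image assms) simp
  then obtain B where "\<And>z. z \<in> sphere 0 1 \<Longrightarrow> norm (f z) \<le> B"
    unfolding bounded_iff by blast
  then show ?thesis
    by (intro integrable_const_bound[of _ B] measurable_continuous assms AE_I2)
      (auto simp: space_circle)
qed

definition ip :: "complex poly \<Rightarrow> complex poly \<Rightarrow> complex" where
  "ip p q = (\<integral>z. poly p z * cnj (poly q z) \<partial>\<mu>)"

definition sqnorm :: "complex poly \<Rightarrow> real" where
  "sqnorm p = (\<integral>z. (cmod (poly p z))\<^sup>2 \<partial>\<mu>)"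

lemma integrable_ip: "integrable \<mu> (\<lambda>z. poly p z * cnj (poly q z))"
  by (intro integrable_continuous continuous_intros)

lemma integrable_sqnorm: "integrable \<mu> (\<lambda>z. (cmod (poly p z))\<^sup>2)"
  by (intro integrable_continuous continuous_intros)

lemma ip_add_left: "ip (p + p') q = ip p q + ip p' q"
  by (simp add: ip_def ring_distribs Bochner_Integration.integral_add integrable_ip)

lemma ip_diff_left: "ip (p - p') q = ip p q - ip p' q"
  by (simp add: ip_def ring_distribs Bochner_Integration.integral_diff integrable_ip)

lemma ip_smult_left: "ip (smult a p) q = a * ip p q"
  by (simp add: ip_def mult.assoc)

lemma cnj_ip: "cnj (ip p q) = ip q p"
  unfolding ip_def by (simp add: mult.commute flip: Bochner_Integration.integral_cnj)

lemma ip_add_right: "ip p (q + q') = ip p q + ip p q'"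
  by (metis cnj_ip ip_add_left complex_cnj_add)

lemma ip_smult_right: "ip p (smult a q) = cnj a * ip p q"
  by (metis cnj_ip ip_smult_left complex_cnj_mult)

lemma ip_zero_left [simp]: "ip 0 q = 0" and ip_zero_right [simp]: "ip q 0 = 0"
  by (simp_all add: ip_def)

lemma ip_sum_left: "ip (\<Sum>j\<in>A. f j) q = (\<Sum>j\<in>A. ip (f j) q)"
  by (induction A rule: infinite_finite_induct) (auto simp: ip_add_left)

lemma ip_self: "ip p p = complex_of_real (sqnorm p)"
  unfolding ip_def sqnorm_def
  by (subst integral_complex_of_real[symmetric]) (simp add: complex_norm_square del: of_real_power)

text \<open>
On the circle \<open>z * cnj z = 1\<close>, so multiplication by \<open>z\<close> is an isometry of \<open>L\<^sup>2(\<mu>)\<close>.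
\<close>

lemma ip_shift: "ip (pCons 0 p) (pCons 0 q) = ip p q"
  unfolding ip_def
proof (intro Bochner_Integration.integral_cong refl)
  fix z assume "z \<in> space \<mu>"
  then have "z * cnj z = 1"
    by (simp add: space_circle complex_norm_square[symmetric])
  then show "poly (pCons 0 p) z * cnj (poly (pCons 0 q) z) = poly p z * cnj (poly q z)"
    by simp
qed

lemma sqnorm_nonneg: "0 \<le> sqnorm p"
  by (simp add: sqnorm_def)

lemma sqnorm_shift: "sqnorm (pCons 0 p) = sqnorm p"
  using ip_shift[of p p] by (simp add: ip_self)

lemma sqnorm_add_le: "sqnorm (p + q) \<le> 2 * sqnorm p + 2 * sqnorm q"
proof -
  have "sqnorm (p + q) \<le> (\<integral>z. 2 * (cmod (poly p z))\<^sup>2 + 2 * (cmod (poly q z))\<^sup>2 \<partial>\<mu>)"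
    unfolding sqnorm_def
  proof (rule integral_mono)
    fix z
    have "(cmod (poly (p + q) z))\<^sup>2 \<le> (cmod (poly p z) + cmod (poly q z))\<^sup>2"
      by (simp add: norm_triangle_ineq power_mono)
    also have "\<dots> \<le> 2 * (cmod (poly p z))\<^sup>2 + 2 * (cmod (poly q z))\<^sup>2"
      using sum_squares_bound[of "cmod (poly p z)" "cmod (poly q z)"]
      by (simp add: power2_sum)
    finally show "(cmod (poly (p + q) z))\<^sup>2 \<le> 2 * (cmod (poly p z))\<^sup>2 + 2 * (cmod (poly q z))\<^sup>2" .
  qed (auto intro!: integrable_sqnorm simp del: poly_add)
  also have "\<dots> = 2 * sqnorm p + 2 * sqnorm q"
    by (simp add: sqnorm_def integrable_sqnorm)
  finally show ?thesis .
qed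

text \<open>
Closeness of \<open>z p\<close> to \<open>\<tau> p\<close> is controlled by the quadratic form \<open>ip (z p) p\<close> alone, because
\<open>z p\<close> has the same norm as \<open>p\<close>. Hence only this form has to be estimated below, and not the
operator \<open>p \<mapsto> z p - \<tau> p\<close> itself.
\<close>

lemma sqnorm_shift_diff:
  "sqnorm (pCons 0 p - smult \<tau> p) = (1 + (cmod \<tau>)\<^sup>2) * sqnorm p - 2 * Re (cnj \<tau> * ip (pCons 0 p) p)"
proof -
  have "complex_of_real (sqnorm (pCons 0 p - smult \<tau> p))
      = ip (pCons 0 p - smult \<tau> p) (pCons 0 p + smult (- \<tau>) p)"
    by (simp add: ip_self)
  also have "\<dots> = (1 + \<tau> * cnj \<tau>) * sqnorm p - (cnj \<tau> * ip (pCons 0 p) p + cnj (cnj \<tau> * ip (pCons 0 p) p))"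
    by (simp only: ip_add_right ip_diff_left ip_smult_left ip_smult_right ip_self sqnorm_shift)
      (simp add: algebra_simps ip_self cnj_ip)
  also have "\<dots> = complex_of_real ((1 + (cmod \<tau>)\<^sup>2) * sqnorm p - 2 * Re (cnj \<tau> * ip (pCons 0 p) p))"
    by (simp only: complex_add_cnj of_real_diff of_real_add of_real_mult of_real_1 of_real_numeral
        complex_norm_square)
  finally show ?thesis
    by (simp only: of_real_eq_iff)
qed

lemma sqnorm_residual:
  "sqnorm (pCons 0 p - smult \<tau> p) = (\<integral>z. (cmod (z - \<tau>))\<^sup>2 * (cmod (poly p z))\<^sup>2 \<partial>\<mu>)"
  unfolding sqnorm_def
  by (simp add: left_diff_distrib[symmetric] norm_mult power_mult_distrib)

lemma sqnorm_residual_le: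
  assumes "cmod \<tau> = 1"
  shows "sqnorm (pCons 0 p - smult \<tau> p) \<le> 4 * sqnorm p"
proof -
  have "sqnorm (smult (-\<tau>) p) = sqnorm p"
    using assms by (simp add: sqnorm_def norm_mult)
  then show ?thesis
    using sqnorm_add_le[of "pCons 0 p" "smult (-\<tau>) p"] by (simp add: sqnorm_shift)
qed

section \<open>The support of the measure\<close>

lemma msupport_subset: "msupport \<mu> \<subseteq> sphere 0 1"
  by (auto simp: msupport_def space_circle)

lemma islimpt_msupport_circle:
  assumes "z islimpt msupport \<mu>"
  shows "z \<in> sphere 0 1"
  using assms islimpt_subset[OF _ msupport_subset] closed_limpt closed_sphere by blast

lemma measure_ball_pos:
  assumes "x \<in> msupport \<mu>" "0 < r"
  shows "0 < prob (ball x r \<inter> sphere 0 1)"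
proof -
  have "0 < emeasure \<mu> (ball x r \<inter> sphere 0 1)"
    using assms by (auto simp: msupport_def space_circle)
  then show ?thesis by (simp add: emeasure_eq_measure)
qed

text \<open>
The complement of the support is a union of open null sets; by the Lindelof property countably
many of them already cover it.
\<close>

lemma AE_msupport: "AE z in \<mu>. z \<in> msupport \<mu>"
proof -
  define \<F> where "\<F> = {U. open U \<and> emeasure \<mu> (U \<inter> space \<mu>) = 0}"
  obtain \<F>' where \<F>': "\<F>' \<subseteq> \<F>" "countable \<F>'" "\<Union>\<F>' = \<Union>\<F>"
    using Lindelof[of \<F>] by (auto simp: \<F>_def)
  have "AE z in \<mu>. z \<notin> U" if "U \<in> \<F>'" for U
  proof -
    have "U \<inter> space \<mu> \<in> null_sets \<mu>"
      using that \<F>'(1) borel_Int_circle[of U] by (auto simp: \<F>_def null_sets_def space_circle)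
    from AE_not_in[OF this] show ?thesis
      by (rule AE_mp) (auto intro!: AE_I2)
  qed
  then have "AE z in \<mu>. \<forall>U\<in>\<F>'. z \<notin> U"
    by (simp add: AE_ball_countable \<F>'(2))
  then show ?thesis
  proof (rule AE_mp, intro AE_I2 impI)
    fix z assume z: "z \<in> space \<mu>" "\<forall>U\<in>\<F>'. z \<notin> U"
    then have "z \<notin> \<Union>\<F>" using \<F>'(3) by blast
    with z show "z \<in> msupport \<mu>"
      by (auto simp: msupport_def \<F>_def zero_less_iff_neq_zero)
  qed
qed

lemma singleton_in_sets: "z \<in> sphere 0 1 \<Longrightarrow> {z} \<in> sets \<mu>"
  using borel_Int_circle[of "{z}"] by (simp add: Int_absorb2)

lemma integral_finite_set:
  fixes g :: "complex \<Rightarrow> real"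
  assumes "finite F" "F \<subseteq> sphere 0 1"
  shows "integrable \<mu> (\<lambda>w. indicator F w * g w)"
    and "(\<integral>w. indicator F w * g w \<partial>\<mu>) = (\<Sum>z\<in>F. prob {z} * g z)"
proof -
  have eq: "indicator F w * g w = (\<Sum>z\<in>F. indicator {z} w * g z)" for w
  proof -
    have "(\<Sum>z\<in>F. indicator {z} w * g z) = (\<Sum>z\<in>F. if z = w then g w else 0)"
      by (intro sum.cong) (auto simp: indicator_def)
    then show ?thesis using assms by (simp add: indicator_def)
  qed
  have int: "integrable \<mu> (\<lambda>w. indicator {z} w * g z)" if "z \<in> F" for z
    using that assms by (auto intro!: integrable_real_indicator singleton_in_sets simp: emeasure_eq_measure)
  show "integrable \<mu> (\<lambda>w. indicator F w * g w)"
    unfolding eq by (intro Bochner_Integration.integrable_sum int)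
  show "(\<integral>w. indicator F w * g w \<partial>\<mu>) = (\<Sum>z\<in>F. prob {z} * g z)"
    unfolding eq by (subst Bochner_Integration.integral_sum[OF int])
      (use assms in \<open>auto intro!: sum.cong simp: space_circle subset_iff Int_absorb2\<close>)
qed

lemma measurable_indicator_times:
  fixes f :: "complex \<Rightarrow> 'b::{real_normed_algebra_1, second_countable_topology}"
  assumes "A \<in> sets borel" "f \<in> borel_measurable \<mu>"
  shows "(\<lambda>z. indicator A z * f z) \<in> borel_measurable \<mu>"
  using borel_Int_circle[OF assms(1)] assms(2)
  by (intro borel_measurable_times) (simp_all add: borel_measurable_indicator_iff space_circle)

lemma integrable_indicator_times:
  fixes f :: "complex \<Rightarrow> 'b::{banach, real_normed_algebra_1, second_countable_topology}"
  assumes "A \<in> sets borel" "continuous_on (sphere 0 1) f"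
  shows "integrable \<mu> (\<lambda>z. indicator A z * f z)"
proof (rule Bochner_Integration.integrable_bound[OF integrable_continuous[OF assms(2)]])
  show "(\<lambda>z. indicator A z * f z) \<in> borel_measurable \<mu>"
    by (intro measurable_indicator_times measurable_continuous assms)
qed (auto simp: indicator_def)

lemma integrable_indicator_sqnorm:
  "A \<in> sets borel \<Longrightarrow> integrable \<mu> (\<lambda>z. indicator A z * (cmod (poly p z))\<^sup>2)"
  by (intro integrable_indicator_times continuous_intros)

section \<open>Polynomials concentrated near a point of the support\<close>

text \<open>
On the circle \<open>\<bar>z + x\<bar>\<^sup>2 = 4 - \<bar>z - x\<bar>\<^sup>2\<close> is largest at \<open>z = x\<close>, so high powers of \<open>z + x\<close> carry
almost all of their \<open>L\<^sup>2\<close> mass near \<open>x\<close>, provided that \<open>\<mu>\<close> charges every neighbourhood of \<open>x\<close>.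
The restriction \<open>r \<le> 2\<close> keeps \<open>4 - r\<^sup>2\<close> nonnegative.
\<close>

lemma peak_polynomial:
  assumes x: "x \<in> msupport \<mu>" and r: "0 < r" "r \<le> 2" and "0 < \<eta>"
  obtains p where "0 < sqnorm p"
    "(\<integral>z. indicator (- ball x r) z * (cmod (poly p z))\<^sup>2 \<partial>\<mu>) \<le> \<eta> * sqnorm p"
proof -
  \<comment> \<open>\<open>a\<close> bounds \<open>\<bar>z + x\<bar>\<^sup>2\<close> from below on the ball of radius \<open>r/2\<close>, and \<open>b\<close> bounds it from above
     outside the ball of radius \<open>r\<close>; the powers are compared through \<open>b < a\<close>.\<close>
  define a b m where "a = 4 - (r/2)\<^sup>2" and "b = 4 - r\<^sup>2" and "m = prob (ball x (r/2) \<inter> sphere 0 1)"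
  have "r\<^sup>2 \<le> 2\<^sup>2" using r by (intro power_mono) auto
  then have ab: "0 \<le> b" "b < a" "0 < a"
    using r by (auto simp: a_def b_def power_divide)
  have m: "0 < m"
    unfolding m_def using r by (intro measure_ball_pos[OF x]) auto
  have "(\<lambda>K. (b / a) ^ K) \<longlonglongrightarrow> 0"
    using ab by (intro LIMSEQ_realpow_zero) auto
  then have "\<forall>\<^sub>F K in sequentially. (b / a) ^ K < \<eta> * m"
    using m \<open>0 < \<eta>\<close> by (intro order_tendstoD(2)) auto
  then obtain K where "(b / a) ^ K < \<eta> * m"
    by (auto simp: eventually_sequentially)
  then have K: "b ^ K \<le> \<eta> * (m * a ^ K)"
    using ab by (simp add: power_divide field_simps)
  define p where "p = [:x, 1:] ^ K"
  have modulus: "(cmod (poly p z))\<^sup>2 = (4 - (dist x z)\<^sup>2) ^ K" if "z \<in> sphere 0 1" for z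
  proof -
    have "(cmod (x + z))\<^sup>2 = 4 - (dist x z)\<^sup>2"
    proof -
      have "(cmod (x + z))\<^sup>2 + (cmod (x - z))\<^sup>2 = 2 * (cmod x)\<^sup>2 + 2 * (cmod z)\<^sup>2"
        by (simp add: power2_norm_eq_inner inner_simps inner_commute)
      moreover have "cmod x = 1" "cmod z = 1"
        using x msupport_subset that by auto
      ultimately show ?thesis by (simp add: dist_norm)
    qed
    then show ?thesis
      by (simp add: p_def norm_power power_mult[symmetric] mult.commute[of K] power_mult)
  qed
  have "m * a ^ K = (\<integral>z. indicator (ball x (r/2) \<inter> sphere 0 1) z * a ^ K \<partial>\<mu>)"
    by (simp add: m_def space_circle)
  also have "\<dots> \<le> sqnorm p"
    unfolding sqnorm_def
  proof (rule integral_mono)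
    show "integrable \<mu> (\<lambda>z. indicator (ball x (r/2) \<inter> sphere 0 1) z * a ^ K)"
      by (auto intro!: integrable_real_indicator borel_Int_circle simp: emeasure_eq_measure)
    fix z assume "z \<in> space \<mu>"
    then have z: "z \<in> sphere 0 1" by (simp add: space_circle)
    have "a ^ K \<le> (cmod (poly p z))\<^sup>2" if "dist x z < r/2"
      unfolding modulus[OF z] using that ab by (intro power_mono) (auto simp: a_def intro: power_mono)
    then show "indicator (ball x (r/2) \<inter> sphere 0 1) z * a ^ K \<le> (cmod (poly p z))\<^sup>2"
      by (auto simp: indicator_def)
  qed (rule integrable_sqnorm)
  finally have low: "m * a ^ K \<le> sqnorm p" .
  have "(\<integral>z. indicator (- ball x r) z * (cmod (poly p z))\<^sup>2 \<partial>\<mu>) \<le> (\<integral>z. b ^ K \<partial>\<mu>)"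
  proof (rule integral_mono)
    fix z assume "z \<in> space \<mu>"
    then have z: "z \<in> sphere 0 1" by (simp add: space_circle)
    have "0 \<le> 4 - (dist x z)\<^sup>2"
    proof -
      have "dist x z \<le> dist x 0 + dist 0 z" by (rule dist_triangle)
      also have "\<dots> \<le> 2" using x msupport_subset z by (auto simp: dist_commute)
      finally have "(dist x z)\<^sup>2 \<le> 2\<^sup>2" by (intro power_mono) auto
      then show ?thesis by simp
    qed
    then have "(4 - (dist x z)\<^sup>2) ^ K \<le> b ^ K" if "r \<le> dist x z"
      using that r by (intro power_mono) (auto simp: b_def intro: power_mono)
    then show "indicator (- ball x r) z * (cmod (poly p z))\<^sup>2 \<le> b ^ K"
      using modulus[OF z] ab by (auto simp: indicator_def)
  qed (auto intro: integrable_indicator_sqnorm)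
  also have "\<dots> = b ^ K" by (simp add: prob_space)
  also have "\<dots> \<le> \<eta> * sqnorm p"
    using K low \<open>0 < \<eta>\<close> by (meson mult_left_mono order_trans less_imp_le)
  finally have "(\<integral>z. indicator (- ball x r) z * (cmod (poly p z))\<^sup>2 \<partial>\<mu>) \<le> \<eta> * sqnorm p" .
  moreover have "0 < sqnorm p"
    using low m ab by (meson less_le_trans mult_pos_pos zero_less_power)
  ultimately show thesis using that by blast
qed

text \<open>
A limit point \<open>z\<close> may carry an atom, so balls around \<open>z\<close> itself need not be light. Punctured
balls shrink to the empty set, hence have small measure, and they contain balls around other
points of the support.
\<close>

lemma light_ball_near_limit_point:
  assumes z: "z islimpt msupport \<mu>" and "0 < s" "0 < \<eta>"
  obtains x r where "x \<in> msupport \<mu>" "0 < r" "r \<le> 2" "ball x r \<subseteq> ball z s"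
    "prob (ball x r \<inter> sphere 0 1) \<le> \<eta>"
proof -
  define A where "A n = (ball z (1 / Suc n) - {z}) \<inter> sphere 0 1" for n
  have A: "range A \<subseteq> sets \<mu>"
    by (auto simp: A_def intro!: borel_Int_circle)
  have "decseq A"
  proof (rule decseq_SucI)
    have "ball z (1 / Suc (Suc n)) \<subseteq> ball z (1 / Suc n)" for n
      by (intro subset_ball) (simp add: field_simps)
    then show "A (Suc n) \<subseteq> A n" for n
      unfolding A_def by blast
  qed
  have "(\<Inter>n. A n) = {}"
  proof (intro equals0I)
    fix w assume w: "w \<in> (\<Inter>n. A n)"
    then have "0 < dist z w" by (auto simp: A_def)
    then obtain n where "1 / Suc n < dist z w"
      using nat_approx_posE by blast
    with w show False by (auto simp: A_def dest!: spec[of _ n])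
  qed
  then have "(\<lambda>n. prob (A n)) \<longlonglongrightarrow> 0"
    using finite_Lim_measure_decseq[OF A \<open>decseq A\<close>] by simp
  then have "\<forall>\<^sub>F n in sequentially. prob (A n) < \<eta>"
    using \<open>0 < \<eta>\<close> by (intro order_tendstoD(2)) auto
  moreover have "(\<lambda>n. 1 / real (Suc n)) \<longlonglongrightarrow> 0"
    by (rule LIMSEQ_Suc[OF lim_1_over_n])
  then have "\<forall>\<^sub>F n in sequentially. 1 / real (Suc n) < s"
    using \<open>0 < s\<close> by (intro order_tendstoD(2)) auto
  ultimately have "\<forall>\<^sub>F n in sequentially. prob (A n) < \<eta> \<and> 1 / real (Suc n) < s"
    by eventually_elim auto
  then obtain n where n: "prob (A n) < \<eta>" "1 / real (Suc n) < s"
    unfolding eventually_sequentially by blast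
  define t where "t = 1 / real (Suc n)"
  have t: "0 < t" "t \<le> 1" "t < s" using n by (auto simp: t_def)
  obtain x where x: "x \<in> msupport \<mu>" "x \<noteq> z" "dist x z < t"
    using z t unfolding islimpt_approachable by blast
  define r where "r = min (dist x z) (t - dist x z)"
  have r: "0 < r" "r \<le> 2" using x t by (auto simp: r_def)
  have "w \<in> ball z t - {z}" if "w \<in> ball x r" for w
  proof -
    have "dist x w < dist x z" "dist x w + dist x z < t" using that by (auto simp: r_def)
    moreover have "dist z w \<le> dist x z + dist x w"
      by (metis dist_commute dist_triangle)
    ultimately show ?thesis by (auto simp: dist_commute)
  qed
  then have sub: "ball x r \<subseteq> ball z t - {z}" by blast
  then have "prob (ball x r \<inter> sphere 0 1) \<le> prob (A n)"
    using A by (intro finite_measure_mono) (auto simp: A_def t_def)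
  then show thesis
    using that[OF x(1) r] sub t n by force
qed

text \<open>
Inside the ball \<open>q\<close> has small norm because the ball is light, outside it \<open>p\<close> has small norm, and
Cauchy-Schwarz applies to both parts. So concentration of \<open>p\<close> turns into near orthogonality to every
bounded \<open>q\<close>.
\<close>

lemma ip_split_bound:
  assumes C: "\<And>z. z \<in> sphere 0 1 \<Longrightarrow> cmod (poly q z) \<le> C"
    and small: "prob (ball x r \<inter> sphere 0 1) \<le> \<eta>"
    and peak: "(\<integral>z. indicator (- ball x r) z * (cmod (poly p z))\<^sup>2 \<partial>\<mu>) \<le> \<eta> * sqnorm p"
  shows "(cmod (ip p q))\<^sup>2 \<le> 2 * (C\<^sup>2 + sqnorm q) * \<eta> * sqnorm p"
proof -
  define B where "B = ball x r"
  define I1 I2 where "I1 = (\<integral>z. poly p z * (indicator B z * cnj (poly q z)) \<partial>\<mu>)"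
    and "I2 = (\<integral>z. (indicator (- B) z * poly p z) * cnj (poly q z) \<partial>\<mu>)"
  have B: "B \<in> sets borel" "- B \<in> sets borel" by (simp_all add: B_def)
  have meas: "poly p \<in> borel_measurable \<mu>" "(\<lambda>z. cnj (poly q z)) \<in> borel_measurable \<mu>"
    by (intro measurable_continuous continuous_intros)+
  have sq: "(cmod (indicator A z * w))\<^sup>2 = indicator A z * (cmod w)\<^sup>2" for A and z w :: complex
    by (simp add: indicator_def)
  have C0: "0 \<le> C"
    using C[of 1] norm_ge_zero order_trans by (metis dist_0_norm mem_sphere norm_one)
  have "0 \<le> \<eta>" using small measure_nonneg order_trans by blast
  have "(cmod I1)\<^sup>2 \<le> sqnorm p * (\<integral>z. indicator B z * (cmod (poly q z))\<^sup>2 \<partial>\<mu>)"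
    unfolding I1_def sqnorm_def
    using integral_Cauchy_Schwarz[of "poly p" \<mu> "\<lambda>z. indicator B z * cnj (poly q z)"]
      integrable_sqnorm[of p] integrable_indicator_sqnorm[OF B(1), of q]
    by (simp add: sq meas measurable_indicator_times B)
  also have "(\<integral>z. indicator B z * (cmod (poly q z))\<^sup>2 \<partial>\<mu>) \<le> (\<integral>z. indicator (B \<inter> sphere 0 1) z * C\<^sup>2 \<partial>\<mu>)"
  proof (rule integral_mono)
    show "integrable \<mu> (\<lambda>z. indicator (B \<inter> sphere 0 1) z * C\<^sup>2)"
      by (auto intro!: integrable_real_indicator borel_Int_circle B simp: emeasure_eq_measure)
    show "indicator B z * (cmod (poly q z))\<^sup>2 \<le> indicator (B \<inter> sphere 0 1) z * C\<^sup>2" if "z \<in> space \<mu>" for z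
      using that C[of z] C0 by (auto simp: space_circle indicator_def intro: power_mono)
  qed (rule integrable_indicator_sqnorm[OF B(1)])
  also have "\<dots> = C\<^sup>2 * prob (B \<inter> sphere 0 1)"
    by (simp add: space_circle)
  also have "\<dots> \<le> C\<^sup>2 * \<eta>"
    using small by (intro mult_left_mono) (auto simp: B_def)
  finally have I1: "(cmod I1)\<^sup>2 \<le> sqnorm p * (C\<^sup>2 * \<eta>)"
    by (simp add: mult_left_mono sqnorm_nonneg)
  have "(cmod I2)\<^sup>2 \<le> (\<integral>z. indicator (- B) z * (cmod (poly p z))\<^sup>2 \<partial>\<mu>) * sqnorm q"
    unfolding I2_def sqnorm_def
    using integral_Cauchy_Schwarz[of "\<lambda>z. indicator (- B) z * poly p z" \<mu> "\<lambda>z. cnj (poly q z)"]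
      integrable_sqnorm[of q] integrable_indicator_sqnorm[OF B(2), of p]
    by (simp add: sq meas measurable_indicator_times B)
  also have "\<dots> \<le> (\<eta> * sqnorm p) * sqnorm q"
    using peak by (intro mult_right_mono sqnorm_nonneg) (simp add: B_def)
  finally have I2: "(cmod I2)\<^sup>2 \<le> \<eta> * sqnorm p * sqnorm q" .
  have int1: "integrable \<mu> (\<lambda>z. indicator A z * (poly p z * cnj (poly q z)))" if "A \<in> sets borel" for A
    using that by (intro integrable_indicator_times continuous_intros)
  have "I1 + I2 = (\<integral>z. indicator B z * (poly p z * cnj (poly q z)) + indicator (- B) z * (poly p z * cnj (poly q z)) \<partial>\<mu>)"
    by (subst Bochner_Integration.integral_add[OF int1[OF B(1)] int1[OF B(2)]]) (simp add: I1_def I2_def mult_ac)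
  also have "\<dots> = ip p q"
    unfolding ip_def by (intro Bochner_Integration.integral_cong refl) (simp add: indicator_def)
  finally have "ip p q = I1 + I2" by simp
  then have "(cmod (ip p q))\<^sup>2 \<le> (cmod I1 + cmod I2)\<^sup>2"
    by (simp add: norm_triangle_ineq power_mono)
  also have "\<dots> \<le> 2 * (cmod I1)\<^sup>2 + 2 * (cmod I2)\<^sup>2"
    using sum_squares_bound[of "cmod I1" "cmod I2"] by (simp add: power2_sum)
  also have "\<dots> \<le> 2 * (C\<^sup>2 + sqnorm q) * \<eta> * sqnorm p"
    using I1 I2 by (simp add: algebra_simps)
  finally show ?thesis .
qed

end

section \<open>Orthonormal expansions and the recurrence at the origin\<close>

locale circle_onp = circle_measure +
  fixes \<phi> :: "nat \<Rightarrow> complex poly"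
  assumes onp: "orthonormal_polys \<mu> \<phi>"

begin

definition kappa :: "nat \<Rightarrow> real" where
  "kappa n = Re (lead_coeff (\<phi> n))"

lemma degree_onp [simp]: "degree (\<phi> n) = n"
  using onp by (simp add: orthonormal_polys_def)

lemma kappa_pos: "0 < kappa n" and coeff_onp: "coeff (\<phi> n) n = complex_of_real (kappa n)"
proof -
  obtain k where "0 < k" "coeff (\<phi> n) n = complex_of_real k"
    using onp degree_onp[of n] unfolding orthonormal_polys_def by metis
  then show "0 < kappa n" "coeff (\<phi> n) n = complex_of_real (kappa n)"
    by (simp_all add: kappa_def)
qed

lemma ip_onp: "ip (\<phi> n) (\<phi> m) = (if m = n then 1 else 0)"
  using onp by (simp add: orthonormal_polys_def ip_def)

lemma sqnorm_onp [simp]: "sqnorm (\<phi> n) = 1"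
  using ip_onp[of n n] by (simp add: ip_self)

lemma expansion_exists:
  assumes "\<And>i. n \<le> i \<Longrightarrow> coeff p i = 0"
  shows "\<exists>c. p = (\<Sum>j<n. smult (c j) (\<phi> j))"
  using assms
proof (induction n arbitrary: p)
  case 0
  then show ?case by (simp add: poly_eq_iff)
next
  case (Suc n)
  define d where "d = coeff p n / complex_of_real (kappa n)"
  have "coeff (p - smult d (\<phi> n)) i = 0" if "n \<le> i" for i
  proof (cases "i = n")
    case True
    then show ?thesis using kappa_pos[of n] by (simp add: d_def coeff_onp)
  next
    case False
    then show ?thesis using that Suc.prems[of i] by (simp add: coeff_eq_0)
  qed
  then obtain c where "p - smult d (\<phi> n) = (\<Sum>j<n. smult (c j) (\<phi> j))"
    using Suc.IH by blast
  then have "p = (\<Sum>j<Suc n. smult ((c(n := d)) j) (\<phi> j))"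
    by (simp add: algebra_simps)
  then show ?case by blast
qed

lemma ip_expansion:
  assumes "finite A"
  shows "ip (\<Sum>j\<in>A. smult (c j) (\<phi> j)) (\<phi> i) = (if i \<in> A then c i else 0)"
proof -
  have "ip (\<Sum>j\<in>A. smult (c j) (\<phi> j)) (\<phi> i) = (\<Sum>j\<in>A. if i = j then c j else 0)"
    by (auto simp: ip_sum_left ip_smult_left ip_onp intro!: sum.cong)
  then show ?thesis using assms by simp
qed

lemma onp_expansion:
  assumes "degree p < n"
  shows "p = (\<Sum>j<n. smult (ip p (\<phi> j)) (\<phi> j))"
proof -
  obtain c where c: "p = (\<Sum>j<n. smult (c j) (\<phi> j))"
    using expansion_exists[of n p] assms by (metis coeff_eq_0 order_less_le_trans)
  then have "ip p (\<phi> j) = c j" if "j < n" for j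
    using that by (simp add: ip_expansion)
  with c show ?thesis by simp
qed

lemma Parseval:
  assumes "finite A"
  shows "sqnorm (\<Sum>j\<in>A. smult (c j) (\<phi> j)) = (\<Sum>j\<in>A. (cmod (c j))\<^sup>2)"
proof -
  define p where "p = (\<Sum>j\<in>A. smult (c j) (\<phi> j))"
  have "ip (\<phi> j) p = cnj (c j)" if "j \<in> A" for j
    unfolding cnj_ip[of p "\<phi> j", symmetric] using assms that by (simp add: p_def ip_expansion)
  note coeffs = this
  have "complex_of_real (sqnorm p) = (\<Sum>j\<in>A. ip (smult (c j) (\<phi> j)) p)"
    by (simp add: p_def ip_sum_left flip: ip_self)
  also have "\<dots> = (\<Sum>j\<in>A. c j * cnj (c j))"
    by (intro sum.cong) (simp_all add: ip_smult_left coeffs)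
  also have "\<dots> = complex_of_real (\<Sum>j\<in>A. (cmod (c j))\<^sup>2)"
    by (simp add: complex_norm_square del: of_real_power)
  finally show ?thesis
    unfolding p_def by (simp only: of_real_eq_iff)
qed

lemma ip_onp_of_degree_le:
  assumes "degree p \<le> n"
  shows "ip p (\<phi> n) = coeff p n / kappa n"
proof -
  have "p = (\<Sum>j<Suc n. smult (ip p (\<phi> j)) (\<phi> j))"
    by (rule onp_expansion) (use assms in simp)
  then have "coeff p n = coeff (\<Sum>j<Suc n. smult (ip p (\<phi> j)) (\<phi> j)) n"
    by simp
  also have "\<dots> = (\<Sum>j<Suc n. ip p (\<phi> j) * coeff (\<phi> j) n)"
    by (simp add: coeff_sum)
  also have "\<dots> = ip p (\<phi> n) * kappa n"
    by (simp add: coeff_onp coeff_eq_0)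
  finally show ?thesis
    using kappa_pos[of n] by simp
qed

text \<open>
\<open>z \<phi>\<^sub>n\<close> is orthogonal to \<open>z, \<dots>, z\<^sup>n\<close>, since the shift is isometric and \<open>\<phi>\<^sub>n\<close> is orthogonal to
lower degrees. So its inner product with \<open>q\<close> sees only the constant term of \<open>q\<close>.
\<close>

lemma ip_shift_onp:
  assumes "degree q \<le> n"
  shows "ip (pCons 0 (\<phi> n)) q = cnj (poly q 0) * ip (pCons 0 (\<phi> n)) 1"
proof -
  obtain a q1 where q: "q = pCons a q1" by (cases q)
  have "ip (\<phi> n) q1 = 0"
  proof (cases "q1 = 0")
    case False
    then have "degree q1 < n" using assms q by simp
    then show ?thesis
      using ip_onp_of_degree_le[of q1 n] cnj_ip[of q1 "\<phi> n"] by (simp add: coeff_eq_0)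
  qed simp
  moreover have "q = smult a 1 + pCons 0 q1"
    by (simp add: q)
  ultimately show ?thesis
    by (simp only: ip_add_right ip_smult_right ip_shift) (simp add: q)
qed

definition ratio :: "nat \<Rightarrow> real" where
  "ratio n = kappa n / kappa (Suc n)"

lemma ratio_pos: "0 < ratio n"
  by (simp add: ratio_def kappa_pos)

lemma ip_shift_onp_Suc: "ip (pCons 0 (\<phi> n)) (\<phi> (Suc n)) = ratio n"
  by (subst ip_onp_of_degree_le) (auto simp: degree_pCons_eq_if coeff_onp ratio_def)

text \<open>
A form of the Szego recurrence. The sum on the right is the Christoffel-Darboux kernel at \<open>0\<close>,
a multiple of the reversed polynomial \<open>\<phi>\<^sub>n\<^sup>*\<close>; with the kernel instead of the reversed
polynomial, everything follows from orthogonal expansion.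
\<close>

lemma shift_onp_expansion:
  "pCons 0 (\<phi> n) = smult (ratio n) (\<phi> (Suc n)) +
     smult (ip (pCons 0 (\<phi> n)) 1) (\<Sum>j\<le>n. smult (cnj (poly (\<phi> j) 0)) (\<phi> j))"
proof -
  define q where "q = pCons 0 (\<phi> n)"
  have coeffs: "ip q (\<phi> j) = cnj (poly (\<phi> j) 0) * ip q 1" if "j \<le> n" for j
    using ip_shift_onp[of "\<phi> j" n] that by (simp add: q_def)
  have "q = (\<Sum>j<Suc (Suc n). smult (ip q (\<phi> j)) (\<phi> j))"
    by (rule onp_expansion) (simp add: q_def degree_pCons_eq_if)
  also have "\<dots> = smult (ratio n) (\<phi> (Suc n)) + (\<Sum>j\<le>n. smult (ip q (\<phi> j)) (\<phi> j))"
    by (simp add: q_def ip_shift_onp_Suc lessThan_Suc_atMost)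
  also have "(\<Sum>j\<le>n. smult (ip q (\<phi> j)) (\<phi> j)) = smult (ip q 1) (\<Sum>j\<le>n. smult (cnj (poly (\<phi> j) 0)) (\<phi> j))"
    by (simp add: smult_sum_right coeffs mult.commute)
  finally show ?thesis by (simp only: q_def)
qed

text \<open>
The value at \<open>0\<close> of the monic orthogonal polynomial; up to sign, conjugation and an index shift
these are the Verblunsky coefficients of \<open>\<mu>\<close>.
\<close>

definition monic_at_0 :: "nat \<Rightarrow> complex" where
  "monic_at_0 n = poly (\<phi> n) 0 / kappa n"

text \<open>
Two readings of the recurrence, its norm and its value at \<open>0\<close>, determine both the kernel
\<open>S n = \<Sum>j\<le>n. \<bar>\<phi>\<^sub>j(0)\<bar>\<^sup>2\<close> and the constant \<open>t n = ip (z \<phi>\<^sub>n) 1\<close>: eliminating \<open>t n\<close> gives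
\<open>ratio\<^sup>2 * S (n + 1) = S n\<close>, the recursion of \<open>kappa\<^sup>2\<close>.
\<close>

lemma sum_sq_onp_at_0: "(\<Sum>j\<le>n. (cmod (poly (\<phi> j) 0))\<^sup>2) = (kappa n)\<^sup>2"
  and ip_shift_onp_one: "ip (pCons 0 (\<phi> n)) 1 = - monic_at_0 (Suc n) / kappa n"
  and ratio_sq: "(ratio n)\<^sup>2 = 1 - (cmod (monic_at_0 (Suc n)))\<^sup>2"
proof -
  define S where "S n = (\<Sum>j\<le>n. (cmod (poly (\<phi> j) 0))\<^sup>2)" for n
  define t where "t n = ip (pCons 0 (\<phi> n)) 1" for n
  have zero: "ratio n * poly (\<phi> (Suc n)) 0 = - t n * S n" for n
  proof -
    have "0 = ratio n * poly (\<phi> (Suc n)) 0 + t n * S n"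
      using arg_cong[OF shift_onp_expansion[of n], of "\<lambda>p. poly p 0"]
      by (simp add: poly_sum t_def S_def complex_norm_square mult.commute del: of_real_power)
    then show ?thesis by (simp add: add_eq_0_iff)
  qed
  have norm: "(ratio n)\<^sup>2 + (cmod (t n))\<^sup>2 * S n = 1" for n
  proof -
    define c where "c j = (if j = Suc n then complex_of_real (ratio n) else t n * cnj (poly (\<phi> j) 0))" for j
    have "pCons 0 (\<phi> n) = (\<Sum>j\<le>Suc n. smult (c j) (\<phi> j))"
      by (subst shift_onp_expansion) (simp add: c_def t_def smult_sum_right add.commute)
    moreover have "sqnorm (pCons 0 (\<phi> n)) = 1"
      using ip_onp[of n n] by (simp add: sqnorm_shift ip_self)
    ultimately have "1 = (\<Sum>j\<le>Suc n. (cmod (c j))\<^sup>2)"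
      by (simp only: Parseval finite_atMost)
    also have "\<dots> = (ratio n)\<^sup>2 + (cmod (t n))\<^sup>2 * S n"
      by (simp add: c_def S_def norm_mult power_mult_distrib sum_distrib_left)
    finally show ?thesis by simp
  qed
  have S: "S n = (kappa n)\<^sup>2" for n
  proof (induction n)
    case 0
    have "poly (\<phi> 0) 0 = kappa 0"
      using coeff_onp[of 0] by (simp add: poly_0_coeff_0)
    then show ?case by (simp add: S_def)
  next
    case (Suc n)
    define b where "b = cmod (poly (\<phi> (Suc n)) 0)"
    have "ratio n * b = cmod (t n) * S n"
      using arg_cong[OF zero[of n], of cmod] ratio_pos[of n] sum_nonneg[of "{..n}" "\<lambda>j. (cmod (poly (\<phi> j) 0))\<^sup>2"]
      by (simp add: norm_mult b_def S_def del: of_real_sum)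
    then have "(ratio n)\<^sup>2 * b\<^sup>2 = (cmod (t n))\<^sup>2 * S n * S n"
      by (metis power2_eq_square power_mult_distrib mult.assoc)
    also have "\<dots> = (1 - (ratio n)\<^sup>2) * S n"
      using norm[of n] by (metis add_diff_cancel_left')
    finally have "(ratio n)\<^sup>2 * S (Suc n) = S n"
      by (simp add: S_def b_def algebra_simps)
    then have "(kappa n / kappa (Suc n))\<^sup>2 * S (Suc n) = (kappa n)\<^sup>2"
      by (simp add: Suc.IH ratio_def)
    then show ?case
      using kappa_pos[of n] kappa_pos[of "Suc n"] by (simp add: field_simps)
  qed
  show "(\<Sum>j\<le>n. (cmod (poly (\<phi> j) 0))\<^sup>2) = (kappa n)\<^sup>2"
    using S by (simp add: S_def)
  have lcs: "kappa n \<noteq> 0" "kappa (Suc n) \<noteq> 0"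
    using kappa_pos by (metis less_irrefl)+
  have t: "t n = - monic_at_0 (Suc n) / kappa n"
  proof -
    have "kappa n * poly (\<phi> (Suc n)) 0 = kappa n * (- t n * kappa n * kappa (Suc n))"
      using zero[of n] lcs by (simp add: S ratio_def field_simps power2_eq_square)
    then have "poly (\<phi> (Suc n)) 0 = - t n * kappa n * kappa (Suc n)"
      using lcs by (simp only: mult_left_cancel of_real_eq_0_iff simp_thms)
    then show ?thesis
      using lcs by (simp add: monic_at_0_def)
  qed
  then show "ip (pCons 0 (\<phi> n)) 1 = - monic_at_0 (Suc n) / kappa n"
    by (simp add: t_def)
  show "(ratio n)\<^sup>2 = 1 - (cmod (monic_at_0 (Suc n)))\<^sup>2"
    using norm[of n] lcs by (simp add: t S norm_divide power_divide)
qed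

lemma norm_monic_at_0_le: "cmod (monic_at_0 n) \<le> 1"
proof -
  have "(cmod (poly (\<phi> n) 0))\<^sup>2 \<le> (\<Sum>j\<le>n. (cmod (poly (\<phi> j) 0))\<^sup>2)"
    by (rule member_le_sum) auto
  then have "cmod (poly (\<phi> n) 0) \<le> kappa n"
    using kappa_pos[of n] by (simp add: sum_sq_onp_at_0)
  then show ?thesis
    using kappa_pos[of n] by (simp add: monic_at_0_def norm_divide)
qed

lemma ip_shift_onp_of_degree_le:
  assumes "degree q \<le> n"
  shows "ip (pCons 0 (\<phi> n)) q = - monic_at_0 (Suc n) * cnj (poly q 0 / kappa n)"
  using ip_shift_onp[OF assms] by (simp add: ip_shift_onp_one)

text \<open>
The bridge between the first moment of \<open>\<bar>\<phi>\<^sub>n\<bar>\<^sup>2 \<mu>\<close> and consecutive values \<open>\<Phi>\<^sub>n(0)\<close>.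
\<close>

lemma ip_shift_onp_self: "ip (pCons 0 (\<phi> n)) (\<phi> n) = - monic_at_0 (Suc n) * cnj (monic_at_0 n)"
  using ip_shift_onp_of_degree_le[of "\<phi> n" n] by (simp add: monic_at_0_def)

section \<open>Multiplication by the variable on tails of the expansion\<close>

text \<open>
Appending a term \<open>c\<^sub>m\<^sub>+\<^sub>1 \<phi>\<^sub>m\<^sub>+\<^sub>1\<close> interacts with the earlier terms only through \<open>c\<^sub>m\<close> (the subdiagonal of
the matrix of the shift) and through \<open>p(0) / \<kappa>\<^sub>m\<close> (its upper triangle), each time with a factor
\<open>\<kappa>\<^sub>m / \<kappa>\<^sub>m\<^sub>+\<^sub>1 \<le> \<epsilon>\<close>. Carrying the squares of these two quantities along in the induction, as the second
summand on the left, makes the bound on the quadratic form independent of the number of terms;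
smallness of the individual columns of the matrix would not suffice for that.
\<close>

lemma shift_form_tail_estimate:
  fixes c :: "nat \<Rightarrow> complex"
  assumes eps: "0 < \<epsilon>" "\<epsilon> \<le> 1/2" and "N \<le> m"
    and diag: "\<And>n. N \<le> n \<Longrightarrow> cmod (ip (pCons 0 (\<phi> n)) (\<phi> n) - \<tau>) \<le> \<epsilon>"
    and small: "\<And>n. N \<le> n \<Longrightarrow> ratio n \<le> \<epsilon>"
  defines "p \<equiv> \<lambda>m. \<Sum>n=N..m. smult (c n) (\<phi> n)"
  shows "cmod (ip (pCons 0 (p m)) (p m) - \<tau> * sqnorm (p m)) +
      \<epsilon> * ((cmod (poly (p m) 0 / kappa m))\<^sup>2 + (cmod (c m))\<^sup>2) \<le> 5 * \<epsilon> * sqnorm (p m)"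
  using \<open>N \<le> m\<close>
proof (induction m rule: dec_induct)
  case base
  define g where "g = ip (pCons 0 (\<phi> N)) (\<phi> N)"
  have p: "p N = smult (c N) (\<phi> N)" by (simp add: p_def)
  have sq: "sqnorm (p N) = (cmod (c N))\<^sup>2"
    using Parseval[of "{N..N}" c] by (simp add: p_def)
  have zp: "pCons 0 (p N) = smult (c N) (pCons 0 (\<phi> N))" by (simp add: p)
  have "ip (pCons 0 (p N)) (p N) - \<tau> * sqnorm (p N) = of_real ((cmod (c N))\<^sup>2) * (g - \<tau>)"
    unfolding sq zp unfolding p
    by (simp add: ip_smult_left ip_smult_right complex_norm_square g_def algebra_simps del: of_real_power smult_pCons)
  then have "cmod (ip (pCons 0 (p N)) (p N) - \<tau> * sqnorm (p N)) = (cmod (c N))\<^sup>2 * cmod (g - \<tau>)"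
    by (simp only: norm_mult norm_of_real) simp
  also have "\<dots> \<le> (cmod (c N))\<^sup>2 * \<epsilon>"
    using diag[of N] by (intro mult_left_mono) (auto simp: g_def)
  finally have 1: "cmod (ip (pCons 0 (p N)) (p N) - \<tau> * sqnorm (p N)) \<le> \<epsilon> * (cmod (c N))\<^sup>2"
    by (simp add: mult.commute)
  have "poly (p N) 0 / kappa N = c N * monic_at_0 N"
    by (simp add: p monic_at_0_def)
  then have "(cmod (poly (p N) 0 / kappa N))\<^sup>2 \<le> (cmod (c N))\<^sup>2"
    using norm_monic_at_0_le[of N] by (simp add: norm_mult mult_left_le)
  then have "\<epsilon> * ((cmod (poly (p N) 0 / kappa N))\<^sup>2 + (cmod (c N))\<^sup>2) \<le> \<epsilon> * (2 * (cmod (c N))\<^sup>2)"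
    using eps by (intro mult_left_mono) auto
  moreover have "0 \<le> \<epsilon> * (cmod (c N))\<^sup>2" using eps by simp
  ultimately show ?case
    using 1 sq by (simp add: algebra_simps)
next
  case (step m)
  define q where "q = p m"
  define e where "e = c (Suc m)"
  define \<psi> where "\<psi> = \<phi> (Suc m)"
  define u where "u = cmod (poly q 0 / kappa m)"
  define v where "v = cmod (c m)"
  define w where "w = cmod e"
  define X where "X = cmod (ip (pCons 0 q) q - \<tau> * sqnorm q)"
  have Sm: "{N..Suc m} = insert (Suc m) {N..m}" using step.hyps by auto
  have p: "p (Suc m) = q + smult e \<psi>"
    by (simp add: p_def q_def e_def \<psi>_def Sm add.commute)
  have deg: "degree q \<le> m"
    unfolding q_def p_def by (intro degree_sum_le) (auto intro: order_trans[OF degree_smult_le])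
  have sq: "sqnorm (p (Suc m)) = sqnorm q + w\<^sup>2"
  proof -
    have "sqnorm (p k) = (\<Sum>n=N..k. (cmod (c n))\<^sup>2)" for k
      unfolding p_def by (rule Parseval) simp
    then show ?thesis by (simp add: q_def w_def e_def Sm)
  qed
  have qm: "ip q (\<phi> m) = c m"
    using step.hyps by (simp add: q_def p_def ip_expansion)
  have "ip (pCons 0 q) \<psi> = coeff q m / kappa (Suc m)"
    unfolding \<psi>_def using deg by (subst ip_onp_of_degree_le) (auto simp: degree_pCons_eq_if)
  also have "coeff q m = c m * kappa m"
    using ip_onp_of_degree_le[OF deg] qm kappa_pos[of m] by simp
  finally have up: "ip (pCons 0 q) \<psi> = c m * ratio m"
    by (simp add: ratio_def)
  have "ip (pCons 0 \<psi>) q = - monic_at_0 (Suc (Suc m)) * cnj (poly q 0 / kappa (Suc m))"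
    unfolding \<psi>_def using deg by (intro ip_shift_onp_of_degree_le) simp
  moreover have "poly q 0 / kappa (Suc m) = ratio m * (poly q 0 / kappa m)"
    using kappa_pos[of m] by (simp add: ratio_def)
  ultimately have dn: "ip (pCons 0 \<psi>) q = - monic_at_0 (Suc (Suc m)) * ratio m * cnj (poly q 0 / kappa m)"
    by simp
  have r: "0 < ratio m" "ratio m \<le> \<epsilon>"
    using small step.hyps ratio_pos by auto
  have nup: "cmod (ip (pCons 0 q) \<psi>) \<le> \<epsilon> * v"
    unfolding up norm_mult norm_of_real v_def using r by (subst mult.commute) (intro mult_right_mono; simp)
  have "cmod (ip (pCons 0 \<psi>) q) = cmod (monic_at_0 (Suc (Suc m))) * (ratio m * u)"
    unfolding dn u_def norm_mult complex_mod_cnj using r by simp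
  also have "\<dots> \<le> 1 * (\<epsilon> * u)"
    using r norm_monic_at_0_le by (intro mult_mono) (auto simp: u_def)
  finally have ndn: "cmod (ip (pCons 0 \<psi>) q) \<le> \<epsilon> * u" by simp
  have zp: "pCons 0 (p (Suc m)) = pCons 0 q + smult e (pCons 0 \<psi>)"
    by (simp add: p)
  have "ip (pCons 0 (p (Suc m))) (p (Suc m)) - \<tau> * sqnorm (p (Suc m)) =
      (ip (pCons 0 q) q - \<tau> * sqnorm q) + cnj e * ip (pCons 0 q) \<psi> + e * ip (pCons 0 \<psi>) q
        + of_real (w\<^sup>2) * (ip (pCons 0 \<psi>) \<psi> - \<tau>)" (is "?L = ?a + ?b + ?c + ?d")
    unfolding zp sq unfolding p
    by (simp add: ip_add_left ip_add_right ip_smult_left ip_smult_right w_def complex_norm_square algebra_simps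
        del: of_real_power smult_pCons add_pCons)
  then have "cmod ?L \<le> cmod ?a + cmod ?b + cmod ?c + cmod ?d"
    by (simp only:) (meson norm_triangle_le add_mono order_refl)
  also have "\<dots> \<le> X + w * (\<epsilon> * v) + w * (\<epsilon> * u) + w\<^sup>2 * \<epsilon>"
  proof -
    have "cmod ?d \<le> w\<^sup>2 * \<epsilon>"
      unfolding norm_mult norm_of_real using diag[of "Suc m"] step.hyps
      by (simp add: \<psi>_def mult_left_mono)
    moreover have "cmod ?b \<le> w * (\<epsilon> * v)" "cmod ?c \<le> w * (\<epsilon> * u)"
      using nup ndn by (simp_all add: norm_mult w_def mult_left_mono)
    ultimately show ?thesis by (simp add: X_def)
  qed
  also have "\<dots> = X + \<epsilon> * (w * v + w * u + w\<^sup>2)"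
    by (simp add: algebra_simps)
  also have "\<dots> \<le> X + \<epsilon> * (v\<^sup>2 / 2 + u\<^sup>2 / 2 + 2 * w\<^sup>2)"
  proof -
    have "w * v + w * u + w\<^sup>2 \<le> v\<^sup>2 / 2 + u\<^sup>2 / 2 + 2 * w\<^sup>2"
      using sum_squares_bound[of w v] sum_squares_bound[of w u] by simp
    then show ?thesis using eps by simp
  qed
  finally have 1: "cmod ?L \<le> X + \<epsilon> * (v\<^sup>2 / 2 + u\<^sup>2 / 2 + 2 * w\<^sup>2)" .
  \<comment> \<open>The normalised value at \<open>0\<close> contracts by \<open>ratio m \<le> 1/2\<close>, so the carried square loses half of
     its weight; the constant \<open>5\<close> is what the new coefficient contributes in total.\<close>
  have "poly (p (Suc m)) 0 / kappa (Suc m) = ratio m * (poly q 0 / kappa m) + e * monic_at_0 (Suc m)"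
    using kappa_pos[of m] kappa_pos[of "Suc m"] by (simp add: p \<psi>_def monic_at_0_def ratio_def add_divide_distrib)
  then have "cmod (poly (p (Suc m)) 0 / kappa (Suc m)) \<le> ratio m * u + w * cmod (monic_at_0 (Suc m))"
    using norm_triangle_ineq[of "ratio m * (poly q 0 / kappa m)" "e * monic_at_0 (Suc m)"] r
    unfolding u_def w_def by (simp only: norm_mult norm_of_real)
  also have "\<dots> \<le> (1/2) * u + w * 1"
    using r eps norm_monic_at_0_le by (intro add_mono mult_mono) (auto simp: u_def w_def)
  finally have "(cmod (poly (p (Suc m)) 0 / kappa (Suc m)))\<^sup>2 \<le> (u / 2 + w)\<^sup>2"
    by (intro power_mono) auto
  also have "\<dots> \<le> u\<^sup>2 / 2 + 2 * w\<^sup>2"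
    using sum_squares_bound[of "u/2" w] by (simp add: power2_sum power_divide)
  finally have "\<epsilon> * ((cmod (poly (p (Suc m)) 0 / kappa (Suc m)))\<^sup>2 + w\<^sup>2) \<le> \<epsilon> * (u\<^sup>2 / 2 + 3 * w\<^sup>2)"
    using eps by (intro mult_left_mono) auto
  with 1 have "cmod ?L + \<epsilon> * ((cmod (poly (p (Suc m)) 0 / kappa (Suc m)))\<^sup>2 + w\<^sup>2)
      \<le> X + \<epsilon> * (v\<^sup>2 / 2 + u\<^sup>2 + 5 * w\<^sup>2)"
    by (simp add: algebra_simps)
  also have "\<dots> \<le> X + \<epsilon> * (u\<^sup>2 + v\<^sup>2) + 5 * \<epsilon> * w\<^sup>2"
    using eps by (simp add: algebra_simps)
  also have "\<dots> \<le> 5 * \<epsilon> * sqnorm (p (Suc m))"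
    using step.IH unfolding sq X_def u_def v_def q_def by (simp add: algebra_simps)
  finally show ?case by (simp add: w_def e_def)
qed

text \<open>
Convergence of \<open>ip (z \<phi>\<^sub>n) \<phi>\<^sub>n = - \<Phi>\<^sub>n\<^sub>+\<^sub>1(0) cnj (\<Phi>\<^sub>n(0))\<close> to a unimodular number forces
\<open>\<bar>\<Phi>\<^sub>n(0)\<bar> \<longlongrightarrow> 1\<close>, hence the ratios of the leading coefficients tend to \<open>0\<close>, and the tail estimate applies.
In operator terms, multiplication by \<open>z - \<tau>\<close> is compact on the closure of the polynomials.
\<close>

lemma tail_residual_small:
  assumes lim: "(\<lambda>n. ip (pCons 0 (\<phi> n)) (\<phi> n)) \<longlonglongrightarrow> \<tau>" and \<tau>: "cmod \<tau> = 1" and "0 < \<epsilon>"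
  obtains N where "\<And>p. (\<And>j. j < N \<Longrightarrow> ip p (\<phi> j) = 0) \<Longrightarrow>
    sqnorm (pCons 0 p - smult \<tau> p) \<le> \<epsilon> * sqnorm p"
proof -
  \<comment> \<open>The tail estimate with \<open>\<delta>\<close> bounds the form up to \<open>5 \<delta>\<close>, and the residual up to twice as much.\<close>
  define \<delta> where "\<delta> = min (1/2) (\<epsilon> / 10)"
  have \<delta>: "0 < \<delta>" "\<delta> \<le> 1/2" "10 * \<delta> \<le> \<epsilon>"
    using \<open>0 < \<epsilon>\<close> by (auto simp: \<delta>_def)
  define x where "x n = cmod (ip (pCons 0 (\<phi> n)) (\<phi> n))" for n
  have "(\<lambda>n. 1 - (x n)\<^sup>2) \<longlonglongrightarrow> 1 - (cmod \<tau>)\<^sup>2"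
    unfolding x_def by (intro tendsto_intros lim)
  then have "(\<lambda>n. 1 - (x n)\<^sup>2) \<longlonglongrightarrow> 0" by (simp add: \<tau>)
  then have "\<forall>\<^sub>F n in sequentially. 1 - (x n)\<^sup>2 < \<delta>\<^sup>2"
    using \<delta> by (intro order_tendstoD(2)) auto
  moreover have "\<forall>\<^sub>F n in sequentially. dist (ip (pCons 0 (\<phi> n)) (\<phi> n)) \<tau> < \<delta>"
    using lim \<delta> by (intro tendstoD)
  ultimately obtain N where N: "\<And>n. N \<le> n \<Longrightarrow> 1 - (x n)\<^sup>2 < \<delta>\<^sup>2"
      "\<And>n. N \<le> n \<Longrightarrow> dist (ip (pCons 0 (\<phi> n)) (\<phi> n)) \<tau> < \<delta>"
    unfolding eventually_sequentially by (metis le_trans linear)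
  have small: "ratio n \<le> \<delta>" if "N \<le> n" for n
  proof (rule power2_le_imp_le)
    have "x n \<le> cmod (monic_at_0 (Suc n))"
      using norm_monic_at_0_le[of n] by (simp add: x_def ip_shift_onp_self norm_mult mult_left_le)
    then have "(x n)\<^sup>2 \<le> (cmod (monic_at_0 (Suc n)))\<^sup>2"
      by (intro power_mono) (auto simp: x_def)
    then show "(ratio n)\<^sup>2 \<le> \<delta>\<^sup>2"
      using N(1)[OF that] by (simp add: ratio_sq)
  qed (use \<delta> in auto)
  show thesis
  proof
    fix p assume orth: "\<And>j. j < N \<Longrightarrow> ip p (\<phi> j) = 0"
    define m where "m = max N (degree p)"
    have "p = (\<Sum>j<Suc m. smult (ip p (\<phi> j)) (\<phi> j))"
      by (rule onp_expansion) (simp add: m_def)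
    also have "\<dots> = (\<Sum>j=N..m. smult (ip p (\<phi> j)) (\<phi> j))"
      by (rule sum.mono_neutral_right) (auto simp: orth not_le)
    finally have p: "(\<Sum>j=N..m. smult (ip p (\<phi> j)) (\<phi> j)) = p" by simp
    have "N \<le> m" by (simp add: m_def)
    from shift_form_tail_estimate[OF \<delta>(1,2) this _ small, of \<tau> "\<lambda>j. ip p (\<phi> j)"] N(2)
    have "cmod (ip (pCons 0 p) p - \<tau> * sqnorm p) +
        \<delta> * ((cmod (poly p 0 / kappa m))\<^sup>2 + (cmod (ip p (\<phi> m)))\<^sup>2) \<le> 5 * \<delta> * sqnorm p"
      unfolding p by (simp add: dist_norm less_imp_le)
    moreover have "0 \<le> \<delta> * ((cmod (poly p 0 / kappa m))\<^sup>2 + (cmod (ip p (\<phi> m)))\<^sup>2)"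
      using \<delta> by simp
    ultimately have est: "cmod (ip (pCons 0 p) p - \<tau> * sqnorm p) \<le> 5 * \<delta> * sqnorm p"
      by linarith
    have \<tau>\<tau>: "cnj \<tau> * \<tau> = 1"
      using \<tau> by (simp add: complex_norm_square[symmetric] mult.commute)
    have "cnj \<tau> * ip (pCons 0 p) p = of_real (sqnorm p) + cnj \<tau> * (ip (pCons 0 p) p - \<tau> * sqnorm p)"
      by (simp add: right_diff_distrib mult.assoc[symmetric] \<tau>\<tau>)
    then have "Re (cnj \<tau> * ip (pCons 0 p) p) = sqnorm p + Re (cnj \<tau> * (ip (pCons 0 p) p - \<tau> * sqnorm p))"
      by (simp only: plus_complex.sel Re_complex_of_real)
    also have "\<dots> \<ge> sqnorm p - cmod (cnj \<tau> * (ip (pCons 0 p) p - \<tau> * sqnorm p))"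
      using abs_Re_le_cmod[of "cnj \<tau> * (ip (pCons 0 p) p - \<tau> * sqnorm p)"] by linarith
    finally have "Re (cnj \<tau> * ip (pCons 0 p) p) \<ge> sqnorm p - 5 * \<delta> * sqnorm p"
      using est by (simp add: norm_mult \<tau>)
    then have "sqnorm (pCons 0 p - smult \<tau> p) \<le> 10 * \<delta> * sqnorm p"
      unfolding sqnorm_shift_diff by (simp add: \<tau>)
    also have "\<dots> \<le> \<epsilon> * sqnorm p"
      using \<delta> by (intro mult_right_mono sqnorm_nonneg)
    finally show "sqnorm (pCons 0 p - smult \<tau> p) \<le> \<epsilon> * sqnorm p" .
  qed
qed

section \<open>Limit points of the support\<close>

text \<open>
Normalised peak polynomials at points of the support that approach a limit point behave like a
weakly null sequence: they are concentrated near the limit point, but nearly orthogonal to any fixed finite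
set of polynomials.
\<close>

lemma almost_orthogonal_peak:
  assumes z: "z islimpt msupport \<mu>" and "0 < s" "0 < \<epsilon>"
  obtains p where "0 < sqnorm p"
    "(\<integral>w. indicator (- ball z s) w * (cmod (poly p w))\<^sup>2 \<partial>\<mu>) \<le> \<epsilon> * sqnorm p"
    "\<And>j. j < N \<Longrightarrow> (cmod (ip p (\<phi> j)))\<^sup>2 \<le> \<epsilon> * sqnorm p"
proof -
  have "bounded (\<Union>j\<in>{..<N}. poly (\<phi> j) ` sphere 0 1)"
    by (intro bounded_UN finite_lessThan ballI compact_imp_bounded compact_continuous_image continuous_intros) simp
  then obtain C where C: "\<And>j w. j < N \<Longrightarrow> w \<in> sphere 0 1 \<Longrightarrow> cmod (poly (\<phi> j) w) \<le> C"
    unfolding bounded_iff by blast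
  \<comment> \<open>\<open>2 * (C\<^sup>2 + 1)\<close> is the factor lost when concentration is turned into near orthogonality.\<close>
  define \<eta> where "\<eta> = \<epsilon> / (2 * (C\<^sup>2 + 1))"
  have C1: "1 \<le> 2 * (C\<^sup>2 + 1)" by simp
  have \<eta>: "0 < \<eta>" "\<eta> \<le> \<epsilon>" "2 * (C\<^sup>2 + 1) * \<eta> = \<epsilon>"
  proof -
    have "C\<^sup>2 + 1 > 0" by (simp add: add_nonneg_pos)
    then show "0 < \<eta>" "2 * (C\<^sup>2 + 1) * \<eta> = \<epsilon>"
      using \<open>0 < \<epsilon>\<close> by (simp_all add: \<eta>_def)
    show "\<eta> \<le> \<epsilon>"
      unfolding \<eta>_def using \<open>0 < \<epsilon>\<close> C1 by (simp add: divide_le_eq mult_le_cancel_left1)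
  qed
  obtain x r where x: "x \<in> msupport \<mu>" "0 < r" "r \<le> 2" "ball x r \<subseteq> ball z s"
      "prob (ball x r \<inter> sphere 0 1) \<le> \<eta>"
    using light_ball_near_limit_point[OF z \<open>0 < s\<close> \<eta>(1)] by blast
  obtain p where p: "0 < sqnorm p"
      "(\<integral>w. indicator (- ball x r) w * (cmod (poly p w))\<^sup>2 \<partial>\<mu>) \<le> \<eta> * sqnorm p"
    using peak_polynomial[OF x(1-3) \<eta>(1)] by blast
  show thesis
  proof
    have "(\<integral>w. indicator (- ball z s) w * (cmod (poly p w))\<^sup>2 \<partial>\<mu>)
        \<le> (\<integral>w. indicator (- ball x r) w * (cmod (poly p w))\<^sup>2 \<partial>\<mu>)"
      using x(4) by (intro integral_mono integrable_indicator_sqnorm mult_right_mono) (auto simp: indicator_def)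
    also have "\<dots> \<le> \<eta> * sqnorm p" by (rule p)
    also have "\<dots> \<le> \<epsilon> * sqnorm p"
      using \<eta>(2) by (intro mult_right_mono sqnorm_nonneg)
    finally show "(\<integral>w. indicator (- ball z s) w * (cmod (poly p w))\<^sup>2 \<partial>\<mu>) \<le> \<epsilon> * sqnorm p" .
  next
    fix j assume "j < N"
    show "(cmod (ip p (\<phi> j)))\<^sup>2 \<le> \<epsilon> * sqnorm p"
      using ip_split_bound[OF C[OF \<open>j < N\<close>] x(5) p(2)] by (simp only: sqnorm_onp \<eta>(3))
  qed (rule p)
qed

text \<open>
A Weyl sequence argument: near a limit point \<open>z \<noteq> \<tau>\<close> there are polynomials that are almost
orthogonal to \<open>\<phi>\<^sub>0, \<dots>, \<phi>\<^sub>N\<^sub>-\<^sub>1\<close> and on which \<open>\<bar>w - \<tau>\<bar>\<close> is bounded below, whereas multiplication by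
\<open>w - \<tau>\<close> is small on everything orthogonal to those finitely many polynomials.
\<close>

lemma limit_point_unique:
  assumes lim: "(\<lambda>n. ip (pCons 0 (\<phi> n)) (\<phi> n)) \<longlonglongrightarrow> \<tau>" and \<tau>: "cmod \<tau> = 1"
    and z: "z islimpt msupport \<mu>"
  shows "z = \<tau>"
proof (rule ccontr)
  assume "z \<noteq> \<tau>"
  define d where "d = dist z \<tau> / 2"
  have "dist z \<tau> \<le> dist z 0 + dist 0 \<tau>" by (rule dist_triangle)
  also have "\<dots> = 2"
    using islimpt_msupport_circle[OF z] \<tau> by (simp add: dist_commute)
  finally have d: "0 < d" "d \<le> 1"
    using \<open>z \<noteq> \<tau>\<close> by (auto simp: d_def)
  then have d2: "0 < d\<^sup>2" "d\<^sup>2 \<le> 1" by (auto simp: power_le_one)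
  define R where "R p = pCons 0 p - smult \<tau> p" for p
  obtain N where N: "\<And>p. (\<And>j. j < N \<Longrightarrow> ip p (\<phi> j) = 0) \<Longrightarrow> sqnorm (R p) \<le> d\<^sup>2 / 32 * sqnorm p"
    using tail_residual_small[OF lim \<tau>, of "d\<^sup>2 / 32"] d2 by (auto simp: R_def)
  define \<epsilon> where "\<epsilon> = d\<^sup>2 / (64 * (real N + 1))"
  have \<epsilon>: "0 < \<epsilon>" "\<epsilon> \<le> 1 / 2" "N * \<epsilon> \<le> d\<^sup>2 / 64"
    using d2 by (auto simp: \<epsilon>_def field_simps)
  obtain p where p: "0 < sqnorm p"
      "(\<integral>w. indicator (- ball z d) w * (cmod (poly p w))\<^sup>2 \<partial>\<mu>) \<le> \<epsilon> * sqnorm p"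
      "\<And>j. j < N \<Longrightarrow> (cmod (ip p (\<phi> j)))\<^sup>2 \<le> \<epsilon> * sqnorm p"
    using almost_orthogonal_peak[OF z d(1) \<epsilon>(1)] by blast
  define S where "S = sqnorm p"
  \<comment> \<open>\<open>p1\<close> is the small component along \<open>\<phi>\<^sub>0, \<dots>, \<phi>\<^sub>N\<^sub>-\<^sub>1\<close>, and \<open>p2\<close> is exactly orthogonal to them.\<close>
  define p1 p2 where "p1 = (\<Sum>j<N. smult (ip p (\<phi> j)) (\<phi> j))" and "p2 = p - p1"
  have "sqnorm p1 = (\<Sum>j<N. (cmod (ip p (\<phi> j)))\<^sup>2)"
    unfolding p1_def by (rule Parseval) simp
  also have "\<dots> \<le> (\<Sum>j<N. \<epsilon> * S)"
    unfolding S_def by (intro sum_mono p) simp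
  also have "\<dots> = (N * \<epsilon>) * S" by simp
  also have "\<dots> \<le> d\<^sup>2 / 64 * S"
    using \<epsilon> p(1) by (intro mult_right_mono) (auto simp: S_def)
  finally have p1: "sqnorm p1 \<le> d\<^sup>2 / 64 * S" .
  have "sqnorm p2 \<le> 2 * S + 2 * sqnorm p1"
  proof -
    have "sqnorm (- p1) = sqnorm p1" by (simp add: sqnorm_def)
    then show ?thesis
      using sqnorm_add_le[of p "- p1"] by (simp add: p2_def S_def)
  qed
  also have "\<dots> \<le> 2 * S + 2 * (1 / 64 * S)"
  proof -
    have "d\<^sup>2 / 64 * S \<le> 1 / 64 * S"
      using d2 p(1) by (intro mult_right_mono) (auto simp: S_def)
    with p1 show ?thesis by linarith
  qed
  also have "\<dots> \<le> 3 * S" using p(1) by (simp add: S_def)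
  finally have p2: "sqnorm p2 \<le> 3 * S" .
  have "ip p2 (\<phi> j) = 0" if "j < N" for j
    using that by (simp add: p2_def p1_def ip_diff_left ip_expansion)
  then have "sqnorm (R p2) \<le> d\<^sup>2 / 32 * sqnorm p2" by (rule N)
  also have "\<dots> \<le> d\<^sup>2 / 32 * (3 * S)"
    using p2 by (intro mult_left_mono) auto
  finally have Rp2: "sqnorm (R p2) \<le> d\<^sup>2 / 32 * (3 * S)" .
  have "R p = R p1 + R p2"
    by (simp add: R_def p2_def smult_diff_right)
  then have "sqnorm (R p) \<le> 2 * sqnorm (R p1) + 2 * sqnorm (R p2)"
    by (simp add: sqnorm_add_le)
  also have "\<dots> \<le> 2 * (4 * (d\<^sup>2 / 64 * S)) + 2 * (d\<^sup>2 / 32 * (3 * S))"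
    using p1 Rp2 sqnorm_residual_le[OF \<tau>, of p1] unfolding R_def by linarith
  finally have upper: "sqnorm (R p) \<le> 5 / 16 * (d\<^sup>2 * S)" by (simp add: mult.commute)
  \<comment> \<open>At least half of the mass of \<open>p\<close> lies in the ball, where \<open>\<bar>w - \<tau>\<bar> \<ge> d\<close>.\<close>
  have "S / 2 \<le> S - (\<integral>w. indicator (- ball z d) w * (cmod (poly p w))\<^sup>2 \<partial>\<mu>)"
    using p(2) mult_right_mono[OF \<epsilon>(2) sqnorm_nonneg[of p]] unfolding S_def by linarith
  also have "\<dots> = (\<integral>w. (cmod (poly p w))\<^sup>2 - indicator (- ball z d) w * (cmod (poly p w))\<^sup>2 \<partial>\<mu>)"
    unfolding S_def sqnorm_def
    by (intro Bochner_Integration.integral_diff[symmetric] integrable_sqnorm integrable_indicator_sqnorm) simp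
  finally have "d\<^sup>2 * (S / 2) \<le> d\<^sup>2 * (\<integral>w. (cmod (poly p w))\<^sup>2 - indicator (- ball z d) w * (cmod (poly p w))\<^sup>2 \<partial>\<mu>)"
    by (intro mult_left_mono) auto
  also have "\<dots> = (\<integral>w. d\<^sup>2 * ((cmod (poly p w))\<^sup>2 - indicator (- ball z d) w * (cmod (poly p w))\<^sup>2) \<partial>\<mu>)"
    by simp
  also have "\<dots> \<le> (\<integral>w. (cmod (w - \<tau>))\<^sup>2 * (cmod (poly p w))\<^sup>2 \<partial>\<mu>)"
  proof (rule integral_mono)
    show "integrable \<mu> (\<lambda>w. d\<^sup>2 * ((cmod (poly p w))\<^sup>2 - indicator (- ball z d) w * (cmod (poly p w))\<^sup>2))"
      by (intro Bochner_Integration.integrable_diff integrable_mult_right integrable_sqnorm integrable_indicator_sqnorm) simp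
    show "integrable \<mu> (\<lambda>w. (cmod (w - \<tau>))\<^sup>2 * (cmod (poly p w))\<^sup>2)"
      by (intro integrable_continuous continuous_intros)
    fix w
    have "d \<le> cmod (w - \<tau>)" if "w \<in> ball z d"
    proof -
      have "2 * d \<le> dist z w + dist w \<tau>"
        using dist_triangle[of z \<tau> w] by (simp add: d_def)
      with that show ?thesis by (simp add: dist_norm)
    qed
    then have "d\<^sup>2 \<le> (cmod (w - \<tau>))\<^sup>2" if "w \<in> ball z d"
      using that d by (intro power_mono) auto
    then show "d\<^sup>2 * ((cmod (poly p w))\<^sup>2 - indicator (- ball z d) w * (cmod (poly p w))\<^sup>2)
        \<le> (cmod (w - \<tau>))\<^sup>2 * (cmod (poly p w))\<^sup>2"
      by (auto simp: indicator_def intro!: mult_right_mono)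
  qed
  also have "\<dots> = sqnorm (R p)"
    by (simp only: R_def sqnorm_residual)
  finally have "d\<^sup>2 * (S / 2) \<le> 5 / 16 * (d\<^sup>2 * S)"
    using upper by linarith
  moreover have "0 < d\<^sup>2 * S" using d2 p(1) by (simp add: S_def)
  ultimately show False by (simp add: mult.commute)
qed

text \<open>
Testing the atom against the kernel polynomial \<open>q = \<Sum>j<n. cnj (\<phi>\<^sub>j(z)) \<phi>\<^sub>j\<close>, whose value at \<open>z\<close> and
squared norm are the same number \<open>K\<close>, gives \<open>\<mu>{z} K \<le> 1\<close>. So the series \<open>\<Sum>j. \<mu>{z} \<bar>\<phi>\<^sub>j(z)\<bar>\<^sup>2\<close> converges.
\<close>

lemma atom_times_onp_tendsto_0:
  assumes "z \<in> sphere 0 1"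
  shows "(\<lambda>n. prob {z} * (cmod (poly (\<phi> n) z))\<^sup>2) \<longlonglongrightarrow> 0"
proof (rule summable_LIMSEQ_zero, rule summableI_nonneg_bounded)
  fix n
  define K where "K = (\<Sum>j<n. (cmod (poly (\<phi> j) z))\<^sup>2)"
  define q where "q = (\<Sum>j<n. smult (cnj (poly (\<phi> j) z)) (\<phi> j))"
  have "poly q z = of_real K"
    by (simp add: q_def K_def poly_sum complex_norm_square mult.commute del: of_real_power)
  have "sqnorm q = K"
    unfolding q_def K_def by (subst Parseval) simp_all
  have "0 \<le> K" unfolding K_def by (intro sum_nonneg) simp
  have "prob {z} * K\<^sup>2 = (\<integral>w. indicator {z} w * (cmod (poly q w))\<^sup>2 \<partial>\<mu>)"
    using assms integral_finite_set(2)[of "{z}"] by (simp add: \<open>poly q z = of_real K\<close>)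
  also have "\<dots> \<le> sqnorm q"
    unfolding sqnorm_def by (intro integral_mono integrable_sqnorm integrable_indicator_sqnorm)
      (auto simp: indicator_def)
  finally have "(prob {z} * K) * K \<le> 1 * K"
    by (simp add: \<open>sqnorm q = K\<close> power2_eq_square mult.assoc)
  then have "prob {z} * K \<le> 1"
    using \<open>0 \<le> K\<close> by (cases "K = 0") (auto simp: mult_le_cancel_right)
  then show "(\<Sum>j<n. prob {z} * (cmod (poly (\<phi> j) z))\<^sup>2) \<le> 1"
    by (simp add: K_def sum_distrib_left)
qed simp

text \<open>
Away from \<open>\<tau>\<close> the support has no limit point and is therefore finite, and at each of these finitely
many points the mass of \<open>\<bar>\<phi>\<^sub>n\<bar>\<^sup>2 \<mu>\<close> tends to \<open>0\<close>.
\<close>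

lemma residual_tendsto_0_of_limit_points:
  assumes unique: "\<And>z. z islimpt msupport \<mu> \<Longrightarrow> z = \<tau>" and \<tau>: "cmod \<tau> = 1"
  shows "(\<lambda>n. sqnorm (pCons 0 (\<phi> n) - smult \<tau> (\<phi> n))) \<longlonglongrightarrow> 0"
proof (rule tendstoI)
  fix e :: real assume "0 < e"
  define d where "d = sqrt (e / 2)"
  have d: "0 < d" "d\<^sup>2 = e / 2" using \<open>0 < e\<close> by (auto simp: d_def)
  define F where "F = msupport \<mu> - ball \<tau> d"
  have F: "F \<subseteq> sphere 0 1" using msupport_subset by (auto simp: F_def)
  have "finite F"
  proof (rule ccontr)
    assume "infinite F"
    then obtain z where "z islimpt F"
      using Heine_Borel_imp_Bolzano_Weierstrass[OF compact_sphere _ F] by blast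
    then have "z = \<tau>"
      using unique islimpt_subset[of z F "msupport \<mu>"] by (auto simp: F_def)
    with \<open>z islimpt F\<close> obtain y where "y \<in> F" "dist y \<tau> < d"
      using d unfolding islimpt_approachable by blast
    then show False by (auto simp: F_def dist_commute)
  qed
  define X where "X n = (\<Sum>z\<in>F. prob {z} * (cmod (poly (\<phi> n) z))\<^sup>2)" for n
  have bound: "sqnorm (pCons 0 (\<phi> n) - smult \<tau> (\<phi> n)) \<le> d\<^sup>2 + 4 * X n" for n
  proof -
    have "sqnorm (pCons 0 (\<phi> n) - smult \<tau> (\<phi> n))
        \<le> (\<integral>z. d\<^sup>2 * (cmod (poly (\<phi> n) z))\<^sup>2 + 4 * (indicator F z * (cmod (poly (\<phi> n) z))\<^sup>2) \<partial>\<mu>)"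
      unfolding sqnorm_residual
    proof (rule integral_mono_AE)
      show "AE z in \<mu>. (cmod (z - \<tau>))\<^sup>2 * (cmod (poly (\<phi> n) z))\<^sup>2
          \<le> d\<^sup>2 * (cmod (poly (\<phi> n) z))\<^sup>2 + 4 * (indicator F z * (cmod (poly (\<phi> n) z))\<^sup>2)"
        using AE_msupport
      proof (rule AE_mp, intro AE_I2 impI)
        fix z assume z: "z \<in> msupport \<mu>"
        have "(cmod (z - \<tau>))\<^sup>2 \<le> d\<^sup>2 + 4 * indicator F z"
        proof (cases "z \<in> F")
          case True
          have "cmod (z - \<tau>) \<le> 2"
            using norm_triangle_ineq4[of z \<tau>] z msupport_subset \<tau> by auto
          then have "(cmod (z - \<tau>))\<^sup>2 \<le> 2\<^sup>2" by (intro power_mono) auto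
          with True show ?thesis by (simp add: add_increasing)
        next
          case False
          then have "cmod (z - \<tau>) < d"
            using z by (simp add: F_def dist_norm norm_minus_commute)
          with False show ?thesis by (simp add: power_mono)
        qed
        from mult_right_mono[OF this, of "(cmod (poly (\<phi> n) z))\<^sup>2"]
        show "(cmod (z - \<tau>))\<^sup>2 * (cmod (poly (\<phi> n) z))\<^sup>2
          \<le> d\<^sup>2 * (cmod (poly (\<phi> n) z))\<^sup>2 + 4 * (indicator F z * (cmod (poly (\<phi> n) z))\<^sup>2)"
          by (simp add: algebra_simps)
      qed
      show "integrable \<mu> (\<lambda>z. (cmod (z - \<tau>))\<^sup>2 * (cmod (poly (\<phi> n) z))\<^sup>2)"
        by (intro integrable_continuous continuous_intros)
    qed (auto intro!: integrable_sqnorm integral_finite_set \<open>finite F\<close> F)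
    also have "\<dots> = d\<^sup>2 * sqnorm (\<phi> n) + 4 * X n"
      using integral_finite_set[OF \<open>finite F\<close> F, of "\<lambda>z. (cmod (poly (\<phi> n) z))\<^sup>2"] integrable_sqnorm[of "\<phi> n"]
      by (simp add: sqnorm_def X_def del: sqnorm_onp)
    finally show ?thesis by simp
  qed
  have "X \<longlonglongrightarrow> (\<Sum>z\<in>F. 0)"
    unfolding X_def using F by (intro tendsto_sum atom_times_onp_tendsto_0) auto
  then have "\<forall>\<^sub>F n in sequentially. X n < e / 8"
    using \<open>0 < e\<close> by (intro order_tendstoD(2)) auto
  then show "\<forall>\<^sub>F n in sequentially. dist (sqnorm (pCons 0 (\<phi> n) - smult \<tau> (\<phi> n))) 0 < e"
  proof eventually_elim
    case (elim n)
    then show ?case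
      using bound[of n] sqnorm_nonneg[of "pCons 0 (\<phi> n) - smult \<tau> (\<phi> n)"] \<open>0 < e\<close> by (simp add: d)
  qed
qed

lemma residual_onp_tendsto_0:
  assumes lim: "(\<lambda>n. ip (pCons 0 (\<phi> n)) (\<phi> n)) \<longlonglongrightarrow> \<tau>" and \<tau>: "cmod \<tau> = 1"
  shows "(\<lambda>n. sqnorm (pCons 0 (\<phi> n) - smult \<tau> (\<phi> n))) \<longlonglongrightarrow> 0"
proof -
  have "(\<lambda>n. 2 - 2 * Re (cnj \<tau> * ip (pCons 0 (\<phi> n)) (\<phi> n))) \<longlonglongrightarrow> 2 - 2 * Re (cnj \<tau> * \<tau>)"
    by (intro tendsto_intros lim)
  moreover have "cnj \<tau> * \<tau> = 1"
    using \<tau> by (simp add: complex_norm_square[symmetric] mult.commute)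
  ultimately show ?thesis
    by (simp add: sqnorm_shift_diff \<tau>)
qed

section \<open>Weak convergence and matrix entries\<close>

end

context circle_measure
begin

lemma integrable_completion_times:
  fixes f g :: "complex \<Rightarrow> complex"
  assumes "f \<in> borel_measurable (completion \<mu>)" "bounded (f ` sphere 0 1)"
    and "continuous_on (sphere 0 1) g"
  shows "integrable (completion \<mu>) (\<lambda>z. f z * g z)"
proof -
  interpret C: prob_space "completion \<mu>" by (rule prob_space_completion)
  obtain B where B: "\<And>z. z \<in> sphere 0 1 \<Longrightarrow> cmod (f z) \<le> B"
    using assms(2) unfolding bounded_iff by blast
  have "integrable \<mu> g" by (rule integrable_continuous) fact
  then have g: "integrable (completion \<mu>) g"
    by (simp add: integrable_completion)
  show ?thesis
  proof (rule Bochner_Integration.integrable_bound[OF integrable_mult_right[OF g]])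
    show "(\<lambda>z. f z * g z) \<in> borel_measurable (completion \<mu>)"
      using assms(1) borel_measurable_integrable[OF g] by (rule borel_measurable_times)
    show "AE z in completion \<mu>. norm (f z * g z) \<le> norm (complex_of_real B * g z)"
    proof (intro AE_I2)
      fix z assume "z \<in> space (completion \<mu>)"
      then have "cmod (f z) \<le> \<bar>B\<bar>" using B[of z] by (simp add: space_circle)
      then show "norm (f z * g z) \<le> norm (complex_of_real B * g z)"
        by (simp add: norm_mult mult_right_mono)
    qed
  qed
qed

end

context circle_onp
begin

text \<open>
The hypothesis says that the probability measures \<open>\<bar>\<phi>\<^sub>n\<bar>\<^sup>2 \<mu>\<close> have vanishing second moment about \<open>\<tau>\<close>,
so a Chebyshev type bound applies: \<open>\<bar>f z - f \<tau>\<bar>\<close> is at most a small constant near \<open>\<tau>\<close> and at most a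
multiple of \<open>\<bar>z - \<tau>\<bar>\<^sup>2\<close> elsewhere.
\<close>

lemma weak_limit:
  assumes res: "(\<lambda>n. sqnorm (pCons 0 (\<phi> n) - smult \<tau> (\<phi> n))) \<longlonglongrightarrow> 0"
    and f: "test_function \<mu> \<tau> f" and \<tau>: "\<tau> \<in> sphere 0 1"
  shows "(\<lambda>n. \<integral>z. f z * complex_of_real ((cmod (poly (\<phi> n) z))\<^sup>2) \<partial>completion \<mu>) \<longlonglongrightarrow> f \<tau>"
proof (rule tendstoI)
  fix e :: real assume "0 < e"
  have meas: "f \<in> borel_measurable (completion \<mu>)" and bdd: "bounded (f ` sphere 0 1)"
    and cont: "continuous (at \<tau> within sphere 0 1) f"
    using f by (auto simp: test_function_def)
  obtain B where B: "\<And>z. z \<in> sphere 0 1 \<Longrightarrow> cmod (f z) \<le> B"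
    using bdd unfolding bounded_iff by blast
  obtain d where d: "0 < d" "\<And>z. z \<in> sphere 0 1 \<Longrightarrow> dist z \<tau> < d \<Longrightarrow> dist (f z) (f \<tau>) < e / 2"
    using cont \<open>0 < e\<close> unfolding continuous_within_eps_delta by (metis half_gt_zero)
  have "0 \<le> B" using B[OF \<tau>] norm_ge_zero order_trans by blast
  define C where "C = 2 * B / d\<^sup>2"
  have bound: "cmod (f z - f \<tau>) \<le> e / 2 + C * (cmod (z - \<tau>))\<^sup>2" if z: "z \<in> sphere 0 1" for z
  proof (cases "dist z \<tau> < d")
    case True
    have "0 \<le> C * (cmod (z - \<tau>))\<^sup>2" using \<open>0 \<le> B\<close> by (simp add: C_def)
    moreover have "cmod (f z - f \<tau>) \<le> e / 2" using d(2)[OF z True] by (simp add: dist_norm)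
    ultimately show ?thesis by linarith
  next
    case False
    then have "d\<^sup>2 \<le> (cmod (z - \<tau>))\<^sup>2" using d(1) by (intro power_mono) (auto simp: dist_norm)
    then have "C * d\<^sup>2 \<le> C * (cmod (z - \<tau>))\<^sup>2"
      using \<open>0 \<le> B\<close> by (intro mult_left_mono) (auto simp: C_def)
    then have "2 * B \<le> C * (cmod (z - \<tau>))\<^sup>2" using d(1) by (simp add: C_def)
    moreover have "cmod (f z - f \<tau>) \<le> B + B"
      using norm_triangle_ineq4[of "f z" "f \<tau>"] B[OF z] B[OF \<tau>] by linarith
    ultimately show ?thesis using \<open>0 < e\<close> by linarith
  qed
  define r where "r n = sqnorm (pCons 0 (\<phi> n) - smult \<tau> (\<phi> n))" for n
  define g where "g n z = complex_of_real ((cmod (poly (\<phi> n) z))\<^sup>2)" for n z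
  have g: "continuous_on (sphere 0 1) (g n)" for n
    unfolding g_def by (intro continuous_intros)
  have est: "cmod ((\<integral>z. f z * g n z \<partial>completion \<mu>) - f \<tau>) \<le> e / 2 + C * r n" for n
  proof -
    have int: "integrable (completion \<mu>) (\<lambda>z. f z * g n z)" "integrable (completion \<mu>) (\<lambda>z. f \<tau> * g n z)"
      by (auto intro!: integrable_completion_times meas bdd g simp: image_constant_conv)
    have "g n \<in> borel_measurable \<mu>" by (rule measurable_continuous) (rule g)
    then have "(\<integral>z. g n z \<partial>completion \<mu>) = (\<integral>z. g n z \<partial>\<mu>)"
      by (rule integral_completion)
    also have "\<dots> = complex_of_real (sqnorm (\<phi> n))"
      unfolding g_def sqnorm_def by (rule integral_complex_of_real)
    finally have "(\<integral>z. g n z \<partial>completion \<mu>) = 1" by simp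
    then have "(\<integral>z. f z * g n z \<partial>completion \<mu>) - f \<tau> = (\<integral>z. f z * g n z - f \<tau> * g n z \<partial>completion \<mu>)"
      by (simp add: Bochner_Integration.integral_diff[OF int])
    also have "cmod \<dots> \<le> (\<integral>z. cmod (f z * g n z - f \<tau> * g n z) \<partial>completion \<mu>)"
      by (rule integral_norm_bound)
    also have "\<dots> \<le> (\<integral>z. e / 2 * (cmod (poly (\<phi> n) z))\<^sup>2 + C * ((cmod (z - \<tau>))\<^sup>2 * (cmod (poly (\<phi> n) z))\<^sup>2) \<partial>completion \<mu>)"
    proof (rule integral_mono)
      show "integrable (completion \<mu>) (\<lambda>z. cmod (f z * g n z - f \<tau> * g n z))"
        by (intro integrable_norm Bochner_Integration.integrable_diff int)
      have "integrable \<mu> (\<lambda>z. e / 2 * (cmod (poly (\<phi> n) z))\<^sup>2 + C * ((cmod (z - \<tau>))\<^sup>2 * (cmod (poly (\<phi> n) z))\<^sup>2))"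
        by (intro integrable_continuous continuous_intros)
      then show "integrable (completion \<mu>) (\<lambda>z. e / 2 * (cmod (poly (\<phi> n) z))\<^sup>2 + C * ((cmod (z - \<tau>))\<^sup>2 * (cmod (poly (\<phi> n) z))\<^sup>2))"
        by (subst integrable_completion) auto
      fix z assume "z \<in> space (completion \<mu>)"
      then have z: "z \<in> sphere 0 1" by (simp add: space_circle)
      have "cmod (f z * g n z - f \<tau> * g n z) = cmod (f z - f \<tau>) * (cmod (poly (\<phi> n) z))\<^sup>2"
        unfolding left_diff_distrib[symmetric] norm_mult g_def norm_of_real by simp
      also have "\<dots> \<le> (e / 2 + C * (cmod (z - \<tau>))\<^sup>2) * (cmod (poly (\<phi> n) z))\<^sup>2"
        using bound[OF z] by (intro mult_right_mono) auto
      finally show "cmod (f z * g n z - f \<tau> * g n z) \<le>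
          e / 2 * (cmod (poly (\<phi> n) z))\<^sup>2 + C * ((cmod (z - \<tau>))\<^sup>2 * (cmod (poly (\<phi> n) z))\<^sup>2)"
        by (simp add: algebra_simps)
    qed
    also have "\<dots> = (\<integral>z. e / 2 * (cmod (poly (\<phi> n) z))\<^sup>2 + C * ((cmod (z - \<tau>))\<^sup>2 * (cmod (poly (\<phi> n) z))\<^sup>2) \<partial>\<mu>)"
      by (intro integral_completion measurable_continuous continuous_intros)
    also have "\<dots> = (\<integral>z. e / 2 * (cmod (poly (\<phi> n) z))\<^sup>2 \<partial>\<mu>) + (\<integral>z. C * ((cmod (z - \<tau>))\<^sup>2 * (cmod (poly (\<phi> n) z))\<^sup>2) \<partial>\<mu>)"
      by (intro Bochner_Integration.integral_add integrable_continuous continuous_intros)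
    also have "\<dots> = e / 2 * sqnorm (\<phi> n) + C * r n"
      unfolding r_def sqnorm_residual by (simp add: sqnorm_def del: sqnorm_onp)
    finally show ?thesis by simp
  qed
  have "(\<lambda>n. C * r n) \<longlonglongrightarrow> C * 0"
    unfolding r_def by (intro tendsto_intros res)
  then have "\<forall>\<^sub>F n in sequentially. C * r n < e / 2"
    using \<open>0 < e\<close> by (intro order_tendstoD(2)) auto
  then have "\<forall>\<^sub>F n in sequentially. dist (\<integral>z. f z * g n z \<partial>completion \<mu>) (f \<tau>) < e"
  proof eventually_elim
    case (elim n)
    then show ?case using est[of n] by (simp add: dist_norm)
  qed
  then show "\<forall>\<^sub>F n in sequentially.
      dist (\<integral>z. f z * complex_of_real ((cmod (poly (\<phi> n) z))\<^sup>2) \<partial>completion \<mu>) (f \<tau>) < e"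
    unfolding g_def .
qed

text \<open>
By Cauchy-Schwarz and \<open>\<parallel>\<phi>\<^sub>m\<parallel> = 1\<close>, the entry in position \<open>(n, m)\<close> of multiplication by \<open>f - f \<tau>\<close> is
bounded by the square root of \<open>\<integral>\<bar>f - f \<tau>\<bar>\<^sup>2 \<bar>\<phi>\<^sub>n\<bar>\<^sup>2 \<partial>\<mu>\<close>, whatever \<open>m\<close> is. The function
\<open>\<bar>f - f \<tau>\<bar>\<^sup>2\<close> is again an admissible test function, and it vanishes at \<open>\<tau>\<close>.
\<close>

lemma matrix_entries_uniform:
  assumes weak: "\<And>f. test_function \<mu> \<tau> f \<Longrightarrow>
      (\<lambda>n. \<integral>z. f z * complex_of_real ((cmod (poly (\<phi> n) z))\<^sup>2) \<partial>completion \<mu>) \<longlonglongrightarrow> f \<tau>"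
    and f: "test_function \<mu> \<tau> f" and "0 < e"
  shows "\<forall>\<^sub>F n in sequentially. \<forall>m.
      dist (\<integral>z. f z * poly (\<phi> n) z * cnj (poly (\<phi> m) z) \<partial>completion \<mu>) (f \<tau> * (if m = n then 1 else 0)) < e"
proof -
  have meas: "f \<in> borel_measurable (completion \<mu>)" and bdd: "bounded (f ` sphere 0 1)"
    and cont: "continuous (at \<tau> within sphere 0 1) f"
    using f by (auto simp: test_function_def)
  define h where "h z = complex_of_real ((cmod (f z - f \<tau>))\<^sup>2)" for z
  obtain B where B: "\<And>z. z \<in> sphere 0 1 \<Longrightarrow> cmod (f z) \<le> B"
    using bdd unfolding bounded_iff by blast
  have h: "test_function \<mu> \<tau> h"
    unfolding test_function_def
  proof (intro conjI)
    show "h \<in> borel_measurable (completion \<mu>)"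
      using meas unfolding h_def by measurable
    have "cmod (h z) \<le> (B + cmod (f \<tau>))\<^sup>2" if "z \<in> sphere 0 1" for z
      unfolding h_def norm_of_real
      using norm_triangle_ineq4[of "f z" "f \<tau>"] B[OF that] by (auto intro!: power_mono)
    then show "bounded (h ` sphere 0 1)"
      unfolding bounded_iff by blast
    show "continuous (at \<tau> within sphere 0 1) h"
      using cont unfolding h_def by (intro continuous_intros)
  qed
  define X where "X n = (\<integral>z. (cmod ((f z - f \<tau>) * poly (\<phi> n) z))\<^sup>2 \<partial>completion \<mu>)" for n
  have "complex_of_real (X n) = (\<integral>z. h z * complex_of_real ((cmod (poly (\<phi> n) z))\<^sup>2) \<partial>completion \<mu>)" for n
    unfolding X_def h_def by (subst integral_complex_of_real[symmetric]) (simp add: norm_mult power_mult_distrib)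
  then have "(\<lambda>n. complex_of_real (X n)) \<longlonglongrightarrow> complex_of_real 0"
    using weak[OF h] by (simp add: h_def)
  then have "X \<longlonglongrightarrow> 0"
    by (simp only: tendsto_of_real_iff)
  then have "\<forall>\<^sub>F n in sequentially. X n < e\<^sup>2"
    using \<open>0 < e\<close> by (intro order_tendstoD(2)) auto
  then show ?thesis
  proof (eventually_elim, intro allI)
    fix n m assume "X n < e\<^sup>2"
    define p q where "p = poly (\<phi> n)" and "q z = cnj (poly (\<phi> m) z)" for z
    have cont_pq: "continuous_on (sphere 0 1) p" "continuous_on (sphere 0 1) q"
      unfolding p_def q_def by (intro continuous_intros)+
    then have meas_pq: "p \<in> borel_measurable (completion \<mu>)" "q \<in> borel_measurable (completion \<mu>)"
      by (auto intro!: measurable_completion measurable_continuous)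
    have int: "integrable (completion \<mu>) (\<lambda>z. f z * (p z * q z))" "integrable (completion \<mu>) (\<lambda>z. f \<tau> * (p z * q z))"
      by (auto intro!: integrable_completion_times meas bdd continuous_intros cont_pq simp: image_constant_conv)
    have "(\<integral>z. p z * q z \<partial>completion \<mu>) = (\<integral>z. p z * q z \<partial>\<mu>)"
      by (intro integral_completion measurable_continuous continuous_intros cont_pq)
    also have "\<dots> = (if m = n then 1 else 0)"
      using ip_onp[of n m] by (simp add: ip_def p_def q_def)
    finally have "(\<integral>z. f z * p z * q z \<partial>completion \<mu>) - f \<tau> * (if m = n then 1 else 0)
        = (\<integral>z. f z * (p z * q z) - f \<tau> * (p z * q z) \<partial>completion \<mu>)"
      by (simp add: Bochner_Integration.integral_diff[OF int] mult.assoc)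
    also have "\<dots> = (\<integral>z. ((f z - f \<tau>) * p z) * q z \<partial>completion \<mu>)"
      by (simp add: algebra_simps)
    finally have eq: "(\<integral>z. f z * p z * q z \<partial>completion \<mu>) - f \<tau> * (if m = n then 1 else 0)
        = (\<integral>z. ((f z - f \<tau>) * p z) * q z \<partial>completion \<mu>)" .
    have "(\<integral>z. (cmod (q z))\<^sup>2 \<partial>completion \<mu>) = (\<integral>z. (cmod (q z))\<^sup>2 \<partial>\<mu>)"
      by (intro integral_completion measurable_continuous continuous_intros cont_pq)
    also have "\<dots> = sqnorm (\<phi> m)" by (simp add: sqnorm_def q_def)
    finally have q1: "(\<integral>z. (cmod (q z))\<^sup>2 \<partial>completion \<mu>) = 1" by simp
    have "(cmod (\<integral>z. ((f z - f \<tau>) * p z) * q z \<partial>completion \<mu>))\<^sup>2 \<le> X n * 1"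
      unfolding X_def q1[symmetric] p_def[symmetric]
    proof (rule integral_Cauchy_Schwarz)
      show "(\<lambda>z. (f z - f \<tau>) * p z) \<in> borel_measurable (completion \<mu>)"
        using meas meas_pq by measurable
      show "q \<in> borel_measurable (completion \<mu>)" by (rule meas_pq)
      have "integrable (completion \<mu>) (\<lambda>z. h z * complex_of_real ((cmod (p z))\<^sup>2))"
        using h by (intro integrable_completion_times continuous_intros cont_pq) (auto simp: test_function_def)
      from integrable_Re[OF this]
      show "integrable (completion \<mu>) (\<lambda>z. (cmod ((f z - f \<tau>) * p z))\<^sup>2)"
        by (simp add: h_def norm_mult power_mult_distrib flip: of_real_mult of_real_power)
      have "integrable \<mu> (\<lambda>z. (cmod (q z))\<^sup>2)"
        by (intro integrable_continuous continuous_intros cont_pq)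
      then show "integrable (completion \<mu>) (\<lambda>z. (cmod (q z))\<^sup>2)"
        by (subst integrable_completion) auto
    qed
    also have "\<dots> < e\<^sup>2" using \<open>X n < e\<^sup>2\<close> by simp
    finally show "dist (\<integral>z. f z * poly (\<phi> n) z * cnj (poly (\<phi> m) z) \<partial>completion \<mu>)
        (f \<tau> * (if m = n then 1 else 0)) < e"
      using \<open>0 < e\<close> unfolding dist_norm eq[unfolded p_def q_def]
      by (simp add: p_def q_def power2_less_imp_less)
  qed
qed

lemma limits_along_diagonals:
  assumes "\<And>e. 0 < e \<Longrightarrow> \<forall>\<^sub>F n in sequentially. \<forall>m. dist (F n m) (a * (if m = n then 1 else 0)) < e"
  shows "(\<lambda>n. F n (nat (int n + k))) \<longlonglongrightarrow> a * (if k = 0 then 1 else (0::complex))"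
    and "uniform_limit (UNIV :: nat set) (\<lambda>n k. F n (n + k)) (\<lambda>k. a * (if k = 0 then 1 else 0)) sequentially"
proof -
  show "(\<lambda>n. F n (nat (int n + k))) \<longlonglongrightarrow> a * (if k = 0 then 1 else 0)"
  proof (rule tendstoI)
    fix e :: real assume "0 < e"
    \<comment> \<open>Beyond \<open>- k\<close> the index is not truncated, and equals \<open>n\<close> only for \<open>k = 0\<close>.\<close>
    have "\<forall>\<^sub>F n in sequentially. nat (- k) < n" by (rule eventually_gt_at_top)
    with assms[OF \<open>0 < e\<close>]
    show "\<forall>\<^sub>F n in sequentially. dist (F n (nat (int n + k))) (a * (if k = 0 then 1 else 0)) < e"
    proof eventually_elim
      case (elim n)
      then have "nat (int n + k) = n \<longleftrightarrow> k = 0" by auto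
      then show ?case using elim(1)[THEN spec, of "nat (int n + k)"] by simp
    qed
  qed
  show "uniform_limit (UNIV :: nat set) (\<lambda>n k. F n (n + k)) (\<lambda>k. a * (if k = 0 then 1 else 0)) sequentially"
  proof (rule uniform_limitI)
    fix e :: real assume "0 < e"
    from assms[OF this]
    show "\<forall>\<^sub>F n in sequentially. \<forall>k\<in>UNIV. dist (F n (n + k)) (a * (if k = 0 then 1 else 0)) < e"
    proof eventually_elim
      case (elim n)
      show ?case
      proof
        fix k
        show "dist (F n (n + k)) (a * (if k = 0 then 1 else 0)) < e"
          using elim[THEN spec, of "n + k"] by simp
      qed
    qed
  qed
qed

lemma test_function_ident: "test_function \<mu> \<tau> (\<lambda>z. z)"
proof -
  have "(\<lambda>z. z) \<in> borel_measurable \<mu>"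
    by (intro measurable_continuous continuous_intros)
  then show ?thesis
    by (auto simp: test_function_def intro!: measurable_completion compact_imp_bounded)
qed

end

section \<open>The equivalence\<close>

text \<open>
The propositional skeleton: all implications lie on cycles through \<open>s\<close>.
\<close>

lemma all_equivalent_cycle:
  assumes "s \<Longrightarrow> r" "i \<Longrightarrow> r" "r \<Longrightarrow> ii" "ii \<Longrightarrow> iii" "iii \<Longrightarrow> v" "v \<Longrightarrow> s" "s \<Longrightarrow> i"
  shows "all_equivalent [i, ii, iii, s, v, s]"
  using assms by (auto simp: all_equivalent_def)

(* For negative k the subscript n + k is truncated at 0; this affects only the finitely
   many n < -k, hence not the limit. *)

theorem theorem6:
  fixes \<mu> :: "complex measure" and \<phi> \<Phi> :: "nat \<Rightarrow> complex poly" and \<tau> :: complex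
  assumes "circle_prob \<mu>"
    and "infinite (msupport \<mu>)"
    and "orthonormal_polys \<mu> \<phi>"
    and "\<And>n. \<Phi> n = monic_poly (\<phi> n)"
    and "\<tau> \<in> sphere 0 1"
  shows "all_equivalent
    [ {z. z islimpt msupport \<mu>} = {\<tau>},

      \<forall>f. test_function \<mu> \<tau> f \<longrightarrow>
        (\<lambda>n. \<integral>z. f z * complex_of_real ((cmod (poly (\<phi> n) z))\<^sup>2) \<partial>completion \<mu>)
          \<longlonglongrightarrow> f \<tau>,

      \<forall>f. test_function \<mu> \<tau> f \<longrightarrow>
        (\<forall>k::int. (\<lambda>n. \<integral>z. f z * poly (\<phi> n) z * cnj (poly (\<phi> (nat (int n + k))) z) \<partial>completion \<mu>)
          \<longlonglongrightarrow> f \<tau> * (if k = 0 then 1 else 0)) \<and>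
        uniform_limit (UNIV :: nat set)
          (\<lambda>n k. \<integral>z. f z * poly (\<phi> n) z * cnj (poly (\<phi> (n + k)) z) \<partial>completion \<mu>)
          (\<lambda>k. f \<tau> * (if k = 0 then 1 else 0)) sequentially,

      (\<lambda>n. \<integral>z. z * complex_of_real ((cmod (poly (\<phi> n) z))\<^sup>2) \<partial>\<mu>) \<longlonglongrightarrow> \<tau>,

      (\<forall>k::int. (\<lambda>n. \<integral>z. z * poly (\<phi> n) z * cnj (poly (\<phi> (nat (int n + k))) z) \<partial>\<mu>)
        \<longlonglongrightarrow> \<tau> * (if k = 0 then 1 else 0)) \<and>
      uniform_limit (UNIV :: nat set)
        (\<lambda>n k. \<integral>z. z * poly (\<phi> n) z * cnj (poly (\<phi> (n + k)) z) \<partial>\<mu>)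
        (\<lambda>k. \<tau> * (if k = 0 then 1 else 0)) sequentially,

      (\<lambda>n. poly (\<Phi> (n + 1)) 0 * cnj (poly (\<Phi> n) 0)) \<longlonglongrightarrow> - \<tau> ]"
    (is "all_equivalent [?i, ?ii, \<forall>f. test_function \<mu> \<tau> f \<longrightarrow> ?limits f, ?iv, ?v, ?vi]")
proof -
  interpret circle_onp \<mu> \<phi>
    using assms by unfold_locales
  let ?iii = "\<forall>f. test_function \<mu> \<tau> f \<longrightarrow> ?limits f"
  have \<tau>: "cmod \<tau> = 1" using assms(5) by simp
  let ?shift = "(\<lambda>n. ip (pCons 0 (\<phi> n)) (\<phi> n)) \<longlonglongrightarrow> \<tau>"
  let ?residual = "(\<lambda>n. sqnorm (pCons 0 (\<phi> n) - smult \<tau> (\<phi> n))) \<longlonglongrightarrow> 0"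
  have iv: "?iv \<longleftrightarrow> ?shift"
    by (simp add: ip_def complex_norm_square mult.assoc del: of_real_power)
  have monic0: "poly (\<Phi> n) 0 = monic_at_0 n" for n
    by (simp add: assms(4) monic_poly_def monic_at_0_def coeff_onp field_simps)
  have vi: "?vi \<longleftrightarrow> ?shift"
    using tendsto_minus_cancel_left[of "\<lambda>n. monic_at_0 (Suc n) * cnj (monic_at_0 n)" \<tau> sequentially]
    by (simp add: monic0 ip_shift_onp_self)
  have "?residual" if ?shift
    using residual_onp_tendsto_0[OF that \<tau>] .
  moreover have "?residual" if ?i
    by (rule residual_tendsto_0_of_limit_points[OF _ \<tau>]) (use that in blast)
  moreover have ?ii if ?residual
    using weak_limit[OF that _ assms(5)] by blast
  moreover have ?iii if ii: ?ii
  proof (intro allI impI)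
    fix f assume f: "test_function \<mu> \<tau> f"
    let ?entry = "\<lambda>n m. \<integral>z. f z * poly (\<phi> n) z * cnj (poly (\<phi> m) z) \<partial>completion \<mu>"
    have "\<forall>\<^sub>F n in sequentially. \<forall>m. dist (?entry n m) (f \<tau> * (if m = n then 1 else 0)) < e" if "0 < e" for e
      using matrix_entries_uniform[OF ii[rule_format] f that] .
    note limits = limits_along_diagonals[of ?entry, OF this]
    show "?limits f"
      by (intro conjI allI; rule limits)
  qed
  moreover have ?v if ?iii
  proof -
    have "(\<integral>z. z * poly (\<phi> n) z * cnj (poly (\<phi> m) z) \<partial>completion \<mu>)
        = (\<integral>z. z * poly (\<phi> n) z * cnj (poly (\<phi> m) z) \<partial>\<mu>)" for n m
      by (intro integral_completion measurable_continuous continuous_intros)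
    then show ?thesis
      using that[THEN spec, THEN mp, OF test_function_ident] by simp
  qed
  moreover have ?shift if ?v
    using that[THEN conjunct1, THEN spec, of 0] by (simp add: ip_def)
  moreover have ?i if ?shift
  proof -
    have "\<exists>z. z islimpt msupport \<mu>"
      using Heine_Borel_imp_Bolzano_Weierstrass[OF compact_sphere assms(2) msupport_subset] by blast
    then show ?thesis
      using limit_point_unique[OF that \<tau>] by blast
  qed
  ultimately show ?thesis
    unfolding iv vi by (rule all_equivalent_cycle)
qed

end
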